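(* Let $(\Omega,\Sigma,\mu)$ be a probability space, let $T:\Omega\to\Omega$ be an ergodic invertible measure-preserving transformation, and let $(a_k)_{k\in\mathbb{Z}}$ be a sequence of positive real numbers with $\sum_{k\in\mathbb{Z}}a_k=1$ and $\sum_{k\in\mathbb{Z}}\sqrt{a_k}<\infty$. Then the norm $$|||f|||=\int_\Omega\Big(\sum_{k\in\mathbb{Z}}a_k|f(T^k\omega)|^2\Big)^{1/2}d\mu(\omega)$$ on $L_1(\mu)$ is weakly midpoint locally uniformly rotund (wMLUR).
   Context: $L_1(\mu)$ is over $\mathbb{K}=\mathbb{R}$ or $\mathbb{C}$. An invertible measure-preserving transformation is a bijection $T:\Omega\to\Omega$ such that $T$ and $T^{-1}$ are measurable and $\mu(T^{-1}(A))=\mu(A)$ for every $A\in\Sigma$. It is ergodic if every $A\in\Sigma$ with $\mu(A\,\Delta\,T^{-1}(A))=0$ satisfies $\mu(A)=0$ or $\mu(A)=1$. The functional $|||\cdot|||$ is an equivalent norm on $L_1(\mu)$, with $\|f\|_1\le|||f|||\le(\sum_{k}\sqrt{a_k})\|f\|_1$. A Banach space $X$ with unit sphere $S_X$ (or its norm) is wMLUR if, whenever $x\in S_X$ and $(h_n)\subseteq X$ satisfy $\|x+h_n\|\to1$ and $\|x-h_n\|\to1$, then $h_n\to0$ weakly. *)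

theory Defs
  imports "HOL-Probability.Probability"
begin

definition invertible_mpt :: "'w measure \<Rightarrow> ('w \<Rightarrow> 'w) \<Rightarrow> bool" where
  "invertible_mpt M T \<longleftrightarrow>
     bij_betw T (space M) (space M) \<and>
     T \<in> M \<rightarrow>\<^sub>M M \<and>
     inv_into (space M) T \<in> M \<rightarrow>\<^sub>M M \<and>
     (\<forall>A\<in>sets M. emeasure M (T -` A \<inter> space M) = emeasure M A)"

definition ergodic :: "'w measure \<Rightarrow> ('w \<Rightarrow> 'w) \<Rightarrow> bool" where
  "ergodic M T \<longleftrightarrow>
     (\<forall>A\<in>sets M. emeasure M (sym_diff A (T -` A \<inter> space M)) = 0 \<longrightarrow>
        emeasure M A = 0 \<or> emeasure M A = 1)"

text \<open>The integer iterates of a bijection of \<open>\<Omega>\<close>; only their values on \<open>\<Omega>\<close> matter.\<close>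

definition int_iterate :: "'w set \<Rightarrow> ('w \<Rightarrow> 'w) \<Rightarrow> int \<Rightarrow> 'w \<Rightarrow> 'w" where
  "int_iterate \<Omega> T k =
     (if k \<ge> 0 then T ^^ nat k else inv_into \<Omega> T ^^ nat (- k))"

text \<open>
  The space \<open>L\<^sub>1(\<mu>)\<close> is represented by the integrable functions themselves, not by classes modulo
  almost everywhere equality. Norms on \<open>L\<^sub>1(\<mu>)\<close> are then seminorms vanishing exactly on the
  functions that are zero almost everywhere. A linear functional bounded by such a seminorm takes
  equal values on almost everywhere equal functions, so the dual defined below is the dual of the
  normed quotient. The scalar field \<open>'k\<close> is meant to be \<open>real\<close> or \<open>complex\<close>.
\<close>

definition L1 :: "'w measure \<Rightarrow> ('w \<Rightarrow> 'k::{real_normed_field, banach, second_countable_topology}) set"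
  where "L1 M = {f. integrable M f}"

definition dual_space ::
  "('w \<Rightarrow> 'k::real_normed_field) set \<Rightarrow> (('w \<Rightarrow> 'k) \<Rightarrow> real) \<Rightarrow> (('w \<Rightarrow> 'k) \<Rightarrow> 'k) set" where
  "dual_space X N = {\<phi>.
     (\<forall>f\<in>X. \<forall>g\<in>X. \<phi> (\<lambda>\<omega>. f \<omega> + g \<omega>) = \<phi> f + \<phi> g) \<and>
     (\<forall>c. \<forall>f\<in>X. \<phi> (\<lambda>\<omega>. c * f \<omega>) = c * \<phi> f) \<and>
     (\<exists>C. \<forall>f\<in>X. norm (\<phi> f) \<le> C * N f)}"

definition weakly_converges ::
  "('w \<Rightarrow> 'k::real_normed_field) set \<Rightarrow> (('w \<Rightarrow> 'k) \<Rightarrow> real) \<Rightarrow> (nat \<Rightarrow> 'w \<Rightarrow> 'k) \<Rightarrow> ('w \<Rightarrow> 'k) \<Rightarrow> bool" where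
  "weakly_converges X N h f \<longleftrightarrow>
     (\<forall>\<phi>\<in>dual_space X N. (\<lambda>n. \<phi> (h n)) \<longlonglongrightarrow> \<phi> f)"

definition wMLUR ::
  "('w \<Rightarrow> 'k::real_normed_field) set \<Rightarrow> (('w \<Rightarrow> 'k) \<Rightarrow> real) \<Rightarrow> bool" where
  "wMLUR X N \<longleftrightarrow>
     (\<forall>f\<in>X. \<forall>h. N f = 1 \<longrightarrow> (\<forall>n. h n \<in> X) \<longrightarrow>
        (\<lambda>n. N (\<lambda>\<omega>. f \<omega> + h n \<omega>)) \<longlonglongrightarrow> 1 \<longrightarrow>
        (\<lambda>n. N (\<lambda>\<omega>. f \<omega> - h n \<omega>)) \<longlonglongrightarrow> 1 \<longrightarrow>
        weakly_converges X N h (\<lambda>\<omega>. 0))"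

text \<open>
  For integrable \<open>f\<close> and summable \<open>sqrt (a k)\<close>, the inner series converges for almost all \<open>\<omega>\<close> and
  the integrand is integrable, since it is dominated by the sum of the
  \<open>sqrt (a k) * norm (f (T\<^sup>k \<omega>))\<close>. So the default value 0 of divergent sums and integrals plays
  no role on \<open>L1 M\<close>.
\<close>

definition orbit_norm ::
  "'w measure \<Rightarrow> ('w \<Rightarrow> 'w) \<Rightarrow> (int \<Rightarrow> real) \<Rightarrow> ('w \<Rightarrow> 'k::real_normed_field) \<Rightarrow> real" where
  "orbit_norm M T a f =
     (\<integral>\<omega>. sqrt (\<Sum>\<^sub>\<infinity>k\<in>UNIV. a k * (norm (f (int_iterate (space M) T k \<omega>)))\<^sup>2) \<partial>M)"

end

theory Submission
  imports Defs
begin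

text \<open>
  At a point \<open>\<omega>\<close>, the integrand of the orbit norm is the Hilbert space norm of the sequence
  \<open>F \<omega> = (sqrt (a k) * f (T\<^sup>k \<omega>))\<^sub>k\<close>. Let \<open>H\<^sub>n\<close> be the corresponding sequences for \<open>h\<^sub>n\<close>. If the norms of \<open>f + h\<^sub>n\<close> and
  \<open>f - h\<^sub>n\<close> tend to that of \<open>f\<close>, the defects \<open>\<parallel>F + H\<^sub>n\<parallel> + \<parallel>F - H\<^sub>n\<parallel> - 2 \<parallel>F\<parallel>\<close>, which are nonnegative,
  tend to zero in \<open>L\<^sub>1\<close>. The norm of a Hilbert space is affine along rays, so this does not make \<open>H\<^sub>n\<close>
  small; it makes \<open>H\<^sub>n\<close> close to \<open>t\<^sub>n F\<close>, where the real number
  \<open>t\<^sub>n \<omega> = (\<parallel>F + H\<^sub>n\<parallel> - \<parallel>F - H\<^sub>n\<parallel>) / (2 \<parallel>F\<parallel>)\<close> lies in \<open>[- 1, 1]\<close> (\<open>midpoint_estimate\<close>).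

  The point \<open>T \<omega>\<close> has the same orbit as \<open>\<omega>\<close>. Comparing the two approximations of \<open>h\<^sub>n\<close> at an orbit point where
  \<open>f\<close> does not vanish, which exists for almost all \<open>\<omega>\<close> by ergodicity, shows that \<open>t\<^sub>n \<circ> T - t\<^sub>n\<close> tends to
  zero in \<open>L\<^sub>1\<close>. By the mean ergodic theorem, every integrable function is, up to its mean and a
  small error, a coboundary \<open>u \<circ> T - u\<close> with bounded \<open>u\<close> (\<open>coboundary_approximation\<close>), and \<open>t\<^sub>n\<close> is
  asymptotically orthogonal to these. So \<open>t\<^sub>n\<close> acts weakly like the constants \<open>c\<^sub>n = \<integral> t\<^sub>n\<close>
  (\<open>asymptotically_invariant_decorrelates\<close>). Tested against \<open>\<parallel>F\<parallel>\<close>, whose integral is \<open>1\<close>, this gives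
  that \<open>c\<^sub>n\<close> differs by a null sequence from the integral of \<open>t\<^sub>n \<parallel>F\<parallel>\<close>; the latter is half the difference of
  the norms of \<open>f + h\<^sub>n\<close> and \<open>f - h\<^sub>n\<close>. So \<open>c\<^sub>n\<close> tends to zero, and \<open>h\<^sub>n\<close>, being close to \<open>t\<^sub>n f\<close> in
  \<open>L\<^sub>1\<close>, tends to zero weakly.

  Two classical tools, the projection theorem in \<open>L\<^sub>2\<close> and the duality of \<open>L\<^sub>1\<close> and \<open>L\<^sub>\<infinity>\<close>, enter only through
  one elementary lemma, \<open>approximate_Riesz\<close>: a near-minimiser of a quadratic functional almost
  represents its linear part. With it one approximates \<open>g\<close> by coboundaries, and functionals on the
  multiples \<open>t f\<close> by integrals.
\<close>

section \<open>Almost representing functionals, and limits in \<open>L\<^sub>1\<close>\<close>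

text \<open>
  A substitute for the Riesz representation theorem on an incomplete space of square integrable
  functions. The representing vector of \<open>\<psi>\<close> would be the minimiser of
  \<open>J u = \<parallel>u\<parallel>\<^sup>2 / 2 - \<psi> u\<close>, which is bounded below. Without completeness the minimum need not be
  attained, but at a near-minimiser the derivative of \<open>J\<close> is small in every direction, and that
  derivative is the difference between the inner product with \<open>u\<close> and \<open>\<psi>\<close>.
\<close>

lemma approximate_Riesz:
  fixes N :: "'a measure" and V :: "('a \<Rightarrow> real) set"
  assumes int: "\<And>u v. u \<in> V \<Longrightarrow> v \<in> V \<Longrightarrow> integrable N (\<lambda>x. u x * v x)"
    and lin: "\<And>u v s. u \<in> V \<Longrightarrow> v \<in> V \<Longrightarrow> (\<lambda>x. u x + s * v x) \<in> V"
    and ne: "V \<noteq> {}"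
    and psi: "\<And>u v s. u \<in> V \<Longrightarrow> v \<in> V \<Longrightarrow> \<psi> (\<lambda>x. u x + s * v x) = \<psi> u + s * \<psi> v"
    and bd: "\<And>v. v \<in> V \<Longrightarrow> \<bar>\<psi> v\<bar> \<le> C * sqrt (\<integral>x. (v x)\<^sup>2 \<partial>N)"
    and eps: "\<epsilon> > 0"
  shows "\<exists>u\<in>V. \<forall>v\<in>V. \<bar>\<psi> v - (\<integral>x. u x * v x \<partial>N)\<bar> \<le> \<epsilon> * sqrt (\<integral>x. (v x)\<^sup>2 \<partial>N)"
proof -
  define J where "J u = (\<integral>x. (u x)\<^sup>2 \<partial>N) / 2 - \<psi> u" for u
  have J_ge: "- C\<^sup>2 / 2 \<le> J v" if "v \<in> V" for v
  proof -
    define q where "q = sqrt (\<integral>x. (v x)\<^sup>2 \<partial>N)"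
    have "q\<^sup>2 = (\<integral>x. (v x)\<^sup>2 \<partial>N)" by (simp add: q_def)
    moreover have "\<psi> v \<le> C * q" using bd[OF that] by (simp add: q_def)
    moreover have "0 \<le> (q - C)\<^sup>2" by simp
    ultimately show ?thesis by (simp add: J_def power2_diff mult_ac)
  qed
  have bdd: "bdd_below (J ` V)"
    by (rule bdd_belowI2[OF J_ge])
  have "(INF v\<in>V. J v) < (INF v\<in>V. J v) + \<epsilon>\<^sup>2 / 2"
    using eps by simp
  then obtain u where u: "u \<in> V" and Ju: "J u < (INF v\<in>V. J v) + \<epsilon>\<^sup>2 / 2"
    using cINF_less_iff[OF ne bdd] by blast
  show ?thesis
  proof (intro bexI[OF _ u] ballI)
    fix v assume v: "v \<in> V"
    define q where "q = sqrt (\<integral>x. (v x)\<^sup>2 \<partial>N)"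
    define D where "D = (\<integral>x. u x * v x \<partial>N) - \<psi> v"
    have q2: "q\<^sup>2 = (\<integral>x. (v x)\<^sup>2 \<partial>N)" by (simp add: q_def)
    have q0: "q \<ge> 0" by (simp add: q_def)
    have pos: "s * D + s\<^sup>2 * q\<^sup>2 / 2 + \<epsilon>\<^sup>2 / 2 > 0" for s
    proof -
      have "(\<integral>x. (u x + s * v x)\<^sup>2 \<partial>N)
          = (\<integral>x. u x * u x + 2 * s * (u x * v x) + s\<^sup>2 * (v x * v x) \<partial>N)"
        by (simp add: power2_eq_square algebra_simps)
      also have "\<dots> = (\<integral>x. u x * u x \<partial>N) + 2 * s * (\<integral>x. u x * v x \<partial>N) + s\<^sup>2 * (\<integral>x. v x * v x \<partial>N)"
        using int[OF u u] int[OF u v] int[OF v v] by simp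
      finally have "J (\<lambda>x. u x + s * v x) = J u + s * D + s\<^sup>2 * q\<^sup>2 / 2"
        unfolding J_def q2 D_def psi[OF u v] by (simp add: power2_eq_square algebra_simps)
      moreover have "(INF v\<in>V. J v) \<le> J (\<lambda>x. u x + s * v x)"
        by (rule cINF_lower[OF bdd lin[OF u v]])
      ultimately show ?thesis using Ju by linarith
    qed
    \<comment> \<open>The optimal step is \<open>s = - sgn D * \<epsilon> / q\<close>; if \<open>q = 0\<close>, any step far enough against \<open>D\<close> will do.\<close>
    have "\<bar>D\<bar> \<le> \<epsilon> * q"
    proof (cases "q = 0")
      case True
      have "D = 0"
      proof (rule ccontr)
        assume "D \<noteq> 0"
        then show False using pos[of "- \<epsilon>\<^sup>2 / D"] True eps by simp
      qed
      then show ?thesis using True by simp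
    next
      case False
      then have qp: "q > 0" using q0 by simp
      have "- sgn D * \<epsilon> / q * D + (- sgn D * \<epsilon> / q)\<^sup>2 * q\<^sup>2 / 2 + \<epsilon>\<^sup>2 / 2 > 0"
        by (rule pos)
      moreover have "(- sgn D * \<epsilon> / q)\<^sup>2 * q\<^sup>2 \<le> \<epsilon>\<^sup>2"
        using qp by (simp add: power_mult_distrib power_divide sgn_if)
      moreover have "- sgn D * \<epsilon> / q * D = - (\<bar>D\<bar> * \<epsilon> / q)"
        by (simp add: abs_sgn mult_ac)
      ultimately have "\<bar>D\<bar> * \<epsilon> / q < \<epsilon>\<^sup>2" by linarith
      then have "\<bar>D\<bar> * \<epsilon> < \<epsilon> * q * \<epsilon>"
        using qp by (simp add: field_simps power2_eq_square)
      then show ?thesis using eps by (simp add: mult.commute)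
    qed
    then show "\<bar>\<psi> v - (\<integral>x. u x * v x \<partial>N)\<bar> \<le> \<epsilon> * sqrt (\<integral>x. (v x)\<^sup>2 \<partial>N)"
      by (simp add: D_def q_def)
  qed
qed

lemma (in prob_space) integral_abs_le_sqrt_integral_square:
  fixes f :: "'a \<Rightarrow> real"
  assumes [measurable]: "f \<in> borel_measurable M" and sq: "integrable M (\<lambda>x. (f x)\<^sup>2)"
  shows "(\<integral>x. \<bar>f x\<bar> \<partial>M) \<le> sqrt (\<integral>x. (f x)\<^sup>2 \<partial>M)"
proof -
  have "integrable M (\<lambda>x. \<bar>f x\<bar>)"
    by (rule square_integrable_imp_integrable) (use sq in auto)
  then have "variance (\<lambda>x. \<bar>f x\<bar>) = (\<integral>x. (f x)\<^sup>2 \<partial>M) - (\<integral>x. \<bar>f x\<bar> \<partial>M)\<^sup>2"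
    using variance_eq[of "\<lambda>x. \<bar>f x\<bar>"] sq by simp
  then have "(\<integral>x. \<bar>f x\<bar> \<partial>M)\<^sup>2 \<le> (\<integral>x. (f x)\<^sup>2 \<partial>M)"
    using variance_positive[of "\<lambda>x. \<bar>f x\<bar>"] by linarith
  then show ?thesis by (rule real_le_rsqrt)
qed

text \<open>
  Completeness of \<open>L\<^sub>1\<close>: an almost everywhere convergent subsequence supplies the limit function, and
  Fatou's lemma turns the Cauchy estimates into convergence in norm of the whole sequence.
\<close>

lemma L1_Cauchy_limit:
  fixes s :: "nat \<Rightarrow> 'a \<Rightarrow> real"
  assumes int[measurable]: "\<And>n. integrable M (s n)"
    and Cauchy: "\<And>e. e > 0 \<Longrightarrow> \<exists>K. \<forall>i\<ge>K. \<forall>j\<ge>K. (\<integral>x. \<bar>s i x - s j x\<bar> \<partial>M) < e"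
  obtains r where "integrable M r" "(\<lambda>n. \<integral>x. \<bar>s n x - r x\<bar> \<partial>M) \<longlonglongrightarrow> 0"
proof -
  have [measurable]: "s n \<in> borel_measurable M" for n using int by auto
  obtain \<sigma> where \<sigma>: "strict_mono \<sigma>" and AEC: "AE x in M. Cauchy (\<lambda>i. s (\<sigma> i) x)"
    using cauchy_L1_AE_cauchy_subseq[of M s] int Cauchy by (auto simp: real_norm_def)
  define r where "r x = lim (\<lambda>i. s (\<sigma> i) x)" for x
  have r_meas[measurable]: "r \<in> borel_measurable M" unfolding r_def by measurable
  have AEr: "AE x in M. (\<lambda>i. s (\<sigma> i) x) \<longlonglongrightarrow> r x"
    using AEC by eventually_elim (simp add: r_def Cauchy_convergent_iff convergent_LIMSEQ_iff)
  have key: "\<exists>K. \<forall>n\<ge>K. (\<integral>\<^sup>+x. ennreal \<bar>s n x - r x\<bar> \<partial>M) \<le> ennreal e" if e: "e > 0" for e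
  proof -
    obtain K where K: "\<And>i j. i \<ge> K \<Longrightarrow> j \<ge> K \<Longrightarrow> (\<integral>x. \<bar>s i x - s j x\<bar> \<partial>M) < e"
      using Cauchy[OF e] by blast
    show ?thesis
    proof (intro exI allI impI)
      fix n assume n: "n \<ge> K"
      have "(\<integral>\<^sup>+x. ennreal \<bar>s n x - r x\<bar> \<partial>M) = (\<integral>\<^sup>+x. liminf (\<lambda>i. ennreal \<bar>s n x - s (\<sigma> i) x\<bar>) \<partial>M)"
      proof (rule nn_integral_cong_AE, use AEr in eventually_elim)
        fix x assume "(\<lambda>i. s (\<sigma> i) x) \<longlonglongrightarrow> r x"
        then have "(\<lambda>i. ennreal \<bar>s n x - s (\<sigma> i) x\<bar>) \<longlonglongrightarrow> ennreal \<bar>s n x - r x\<bar>"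
          by (intro tendsto_ennrealI tendsto_intros)
        from lim_imp_Liminf[OF _ this]
        show "ennreal \<bar>s n x - r x\<bar> = liminf (\<lambda>i. ennreal \<bar>s n x - s (\<sigma> i) x\<bar>)" by simp
      qed
      also have "\<dots> \<le> liminf (\<lambda>i. \<integral>\<^sup>+x. ennreal \<bar>s n x - s (\<sigma> i) x\<bar> \<partial>M)"
        by (rule nn_integral_liminf) measurable
      also have "\<dots> \<le> ennreal e"
      proof -
        have "eventually (\<lambda>i. (\<integral>\<^sup>+x. ennreal \<bar>s n x - s (\<sigma> i) x\<bar> \<partial>M) \<le> ennreal e) sequentially"
          using eventually_ge_at_top[of K]
        proof eventually_elim
          case (elim i)
          then have "\<sigma> i \<ge> K" using seq_suble[OF \<sigma>, of i] by simp
          from K[OF n this] show ?case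
            by (subst nn_integral_eq_integral) (auto intro!: int ennreal_leI)
        qed
        then show ?thesis
          by (intro Liminf_le) auto
      qed
      finally show "(\<integral>\<^sup>+x. ennreal \<bar>s n x - r x\<bar> \<partial>M) \<le> ennreal e" .
    qed
  qed
  have r_int: "integrable M r"
  proof -
    obtain K where "(\<integral>\<^sup>+x. ennreal \<bar>s K x - r x\<bar> \<partial>M) \<le> ennreal 1"
      using key[of 1] by auto
    then have "integrable M (\<lambda>x. s K x - r x)"
      by (intro integrableI_bounded) (auto intro: le_less_trans[OF _ ennreal_one_less_top])
    from Bochner_Integration.integrable_diff[OF int[of K] this] show ?thesis by simp
  qed
  have "(\<lambda>n. \<integral>x. \<bar>s n x - r x\<bar> \<partial>M) \<longlonglongrightarrow> 0"
  proof (rule LIMSEQ_I)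
    fix e :: real assume "e > 0"
    then obtain K where K: "\<And>n. n \<ge> K \<Longrightarrow> (\<integral>\<^sup>+x. ennreal \<bar>s n x - r x\<bar> \<partial>M) \<le> ennreal (e/2)"
      using key[of "e/2"] by auto
    show "\<exists>K. \<forall>n\<ge>K. norm ((\<integral>x. \<bar>s n x - r x\<bar> \<partial>M) - 0) < e"
    proof (intro exI allI impI)
      fix n assume "n \<ge> K"
      from K[OF this] have "ennreal (\<integral>x. \<bar>s n x - r x\<bar> \<partial>M) \<le> ennreal (e/2)"
        by (subst (asm) nn_integral_eq_integral) (auto intro!: int r_int)
      then have "(\<integral>x. \<bar>s n x - r x\<bar> \<partial>M) \<le> e/2" using \<open>e > 0\<close> by (simp add: ennreal_le_iff)
      then show "norm ((\<integral>x. \<bar>s n x - r x\<bar> \<partial>M) - 0) < e"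
        using \<open>e > 0\<close> by (simp add: integral_nonneg_AE)
    qed
  qed
  with r_int show thesis by (rule that)
qed

section \<open>Bounded functions on a measure-preserving system\<close>

locale invertible_system = prob_space M for M :: "'w measure" +
  fixes T :: "'w \<Rightarrow> 'w"
  assumes invertible: "invertible_mpt M T"
begin

lemma measurable_T[measurable]: "T \<in> M \<rightarrow>\<^sub>M M"
  using invertible by (simp add: invertible_mpt_def)

lemma T_space: "x \<in> space M \<Longrightarrow> T x \<in> space M"
  using measurable_T by (rule measurable_space)

lemma distr_T: "distr M M T = M"
  by (rule measure_eqI) (use invertible in \<open>auto simp: invertible_mpt_def emeasure_distr\<close>)

lemma integral_T:
  fixes f :: "'w \<Rightarrow> 'b::{banach, second_countable_topology}"
  assumes "f \<in> borel_measurable M"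
  shows "(\<integral>x. f (T x) \<partial>M) = (\<integral>x. f x \<partial>M)"
  using integral_distr[OF measurable_T assms] by (simp add: distr_T)

lemma integrable_T:
  fixes f :: "'w \<Rightarrow> 'b::{banach, second_countable_topology}"
  shows "integrable M f \<Longrightarrow> integrable M (\<lambda>x. f (T x))"
  using integrable_distr[OF measurable_T, of f] by (simp add: distr_T)

lemma AE_T: "AE x in M. P x \<Longrightarrow> AE x in M. P (T x)"
  using AE_distrD[OF measurable_T, of P, unfolded distr_T] .

definition bounded_measurable :: "('w \<Rightarrow> real) set" where
  "bounded_measurable = {u \<in> borel_measurable M. \<exists>B. \<forall>x\<in>space M. \<bar>u x\<bar> \<le> B}"

lemma bounded_measurableD: "u \<in> bounded_measurable \<Longrightarrow> u \<in> borel_measurable M"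
  by (simp add: bounded_measurable_def)

lemma bounded_measurableI:
  "u \<in> borel_measurable M \<Longrightarrow> (\<And>x. x \<in> space M \<Longrightarrow> \<bar>u x\<bar> \<le> B) \<Longrightarrow> u \<in> bounded_measurable"
  by (auto simp: bounded_measurable_def)

lemma bounded_measurable_bound:
  assumes "u \<in> bounded_measurable"
  shows "\<exists>B\<ge>0. \<forall>x\<in>space M. \<bar>u x\<bar> \<le> B"
proof -
  obtain B where "\<forall>x\<in>space M. \<bar>u x\<bar> \<le> B"
    using assms by (auto simp: bounded_measurable_def)
  then have "\<bar>u x\<bar> \<le> \<bar>B\<bar>" if "x \<in> space M" for x
    using that order_trans[OF _ abs_ge_self[of B]] by simp
  then show ?thesis by (intro exI[of _ "\<bar>B\<bar>"]) simp
qed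

lemma bounded_measurable_combine:
  assumes "u \<in> bounded_measurable" "v \<in> bounded_measurable"
  shows "(\<lambda>x. u x + s * v x) \<in> bounded_measurable"
proof -
  obtain A where A: "A \<ge> 0" "\<forall>x\<in>space M. \<bar>u x\<bar> \<le> A"
    using bounded_measurable_bound[OF assms(1)] by blast
  obtain B where B: "B \<ge> 0" "\<forall>x\<in>space M. \<bar>v x\<bar> \<le> B"
    using bounded_measurable_bound[OF assms(2)] by blast
  show ?thesis
  proof (rule bounded_measurableI)
    fix x assume x: "x \<in> space M"
    have "\<bar>s * v x\<bar> \<le> \<bar>s\<bar> * B" using B(2) x by (simp add: abs_mult mult_left_mono)
    moreover have "\<bar>u x\<bar> \<le> A" using A(2) x by blast
    ultimately show "\<bar>u x + s * v x\<bar> \<le> A + \<bar>s\<bar> * B" by linarith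
  qed (use assms[THEN bounded_measurableD] in measurable)
qed

lemma bounded_measurable_mult:
  assumes "u \<in> bounded_measurable" "v \<in> bounded_measurable"
  shows "(\<lambda>x. u x * v x) \<in> bounded_measurable"
proof -
  obtain A where A: "A \<ge> 0" "\<forall>x\<in>space M. \<bar>u x\<bar> \<le> A"
    using bounded_measurable_bound[OF assms(1)] by blast
  obtain B where B: "B \<ge> 0" "\<forall>x\<in>space M. \<bar>v x\<bar> \<le> B"
    using bounded_measurable_bound[OF assms(2)] by blast
  show ?thesis
  proof (rule bounded_measurableI)
    fix x assume x: "x \<in> space M"
    show "\<bar>u x * v x\<bar> \<le> A * B"
      unfolding abs_mult using A B x by (intro mult_mono) auto
  qed (use assms[THEN bounded_measurableD] in measurable)
qed

lemma bounded_measurable_integrable_scaleR: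
  fixes f :: "'w \<Rightarrow> 'b::{banach, second_countable_topology}"
  assumes u: "u \<in> bounded_measurable" and f: "integrable M f"
  shows "integrable M (\<lambda>x. u x *\<^sub>R f x)"
proof -
  obtain B where B: "B \<ge> 0" "\<forall>x\<in>space M. \<bar>u x\<bar> \<le> B"
    using bounded_measurable_bound[OF u] by blast
  have [measurable]: "u \<in> borel_measurable M" "f \<in> borel_measurable M"
    using bounded_measurableD[OF u] f by simp_all
  show ?thesis
  proof (rule Bochner_Integration.integrable_bound[where f="\<lambda>x. B *\<^sub>R f x"])
    show "AE x in M. norm (u x *\<^sub>R f x) \<le> norm (B *\<^sub>R f x)"
      using B by (intro AE_I2) (simp add: mult_right_mono)
  qed (use f in simp_all)
qed

lemma bounded_measurable_integrable_mult:
  "u \<in> bounded_measurable \<Longrightarrow> integrable M f \<Longrightarrow> integrable M (\<lambda>x. u x * f x)"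
  for f :: "'w \<Rightarrow> real"
  by (drule (1) bounded_measurable_integrable_scaleR) (simp only: real_scaleR_def)

lemma bounded_measurable_const: "(\<lambda>x. c) \<in> bounded_measurable"
  by (auto simp: bounded_measurable_def)

lemma bounded_measurable_integrable:
  assumes "u \<in> bounded_measurable"
  shows "integrable M u"
  using bounded_measurable_integrable_mult[OF assms, of "\<lambda>x. 1"] by simp

lemma bounded_measurable_T:
  assumes u: "u \<in> bounded_measurable"
  shows "(\<lambda>x. u (T x)) \<in> bounded_measurable"
proof -
  obtain B where "\<forall>x\<in>space M. \<bar>u x\<bar> \<le> B"
    using bounded_measurable_bound[OF u] by blast
  then show ?thesis
    using bounded_measurableD[OF u] by (intro bounded_measurableI[of _ B]) (simp_all add: T_space)
qed

lemma bounded_measurable_dense: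
  assumes g: "integrable M g" and eps: "\<epsilon> > 0"
  obtains b where "b \<in> bounded_measurable" "(\<integral>x. \<bar>g x - b x\<bar> \<partial>M) < \<epsilon>"
proof -
  have [measurable]: "g \<in> borel_measurable M" using g by auto
  define b where "b m x = max (- real m) (min (real m) (g x))" for m x
  have "(\<lambda>m. \<integral>x. \<bar>g x - b m x\<bar> \<partial>M) \<longlonglongrightarrow> (\<integral>x. 0 \<partial>M)"
  proof (rule integral_dominated_convergence[where w="\<lambda>x. \<bar>g x\<bar>"])
    show "AE x in M. (\<lambda>m. \<bar>g x - b m x\<bar>) \<longlonglongrightarrow> 0"
    proof (rule AE_I2)
      fix x
      have "eventually (\<lambda>m. \<bar>g x - b m x\<bar> = 0) sequentially"
        using eventually_ge_at_top[of "nat \<lceil>\<bar>g x\<bar>\<rceil>"]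
      proof eventually_elim
        case (elim m)
        then have "\<bar>g x\<bar> \<le> real m" by linarith
        then show ?case by (simp add: b_def)
      qed
      then show "(\<lambda>m. \<bar>g x - b m x\<bar>) \<longlonglongrightarrow> 0" by (rule tendsto_eventually)
    qed
  qed (use g in \<open>auto simp: b_def\<close>)
  then have "eventually (\<lambda>m. (\<integral>x. \<bar>g x - b m x\<bar> \<partial>M) < \<epsilon>) sequentially"
    using eps by (intro order_tendstoD(2)) auto
  then obtain m where m: "(\<integral>x. \<bar>g x - b m x\<bar> \<partial>M) < \<epsilon>"
    by (auto simp: eventually_sequentially)
  have "b m \<in> bounded_measurable"
  proof (rule bounded_measurableI)
    show "b m \<in> borel_measurable M" unfolding b_def by measurable
    show "\<bar>b m x\<bar> \<le> real m" for x by (simp add: b_def)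
  qed
  with m show thesis by (rule that[rotated])
qed

end

section \<open>Coboundaries of an ergodic system\<close>

locale ergodic_system = invertible_system M T for M :: "'w measure" and T +
  assumes ergodic: "ergodic M T"
begin

lemma invariant_set_trivial:
  assumes A[measurable]: "A \<in> sets M" and inv: "AE x in M. T x \<in> A \<longleftrightarrow> x \<in> A"
  shows "(AE x in M. x \<in> A) \<or> (AE x in M. x \<notin> A)"
proof -
  have "sym_diff A (T -` A \<inter> space M) \<in> null_sets M"
  proof (rule AE_iff_null_sets[THEN iffD2])
    show "AE x in M. x \<notin> sym_diff A (T -` A \<inter> space M)"
      using inv AE_space by eventually_elim auto
  qed simp
  then have "emeasure M (sym_diff A (T -` A \<inter> space M)) = 0"
    by (simp add: null_sets_def)
  then have "emeasure M A = 0 \<or> emeasure M A = 1"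
    using ergodic A unfolding ergodic_def by blast
  then show ?thesis
    using prob_eq_0[OF A] prob_eq_1[OF A] by (auto simp: emeasure_eq_measure)
qed

text \<open>
  The set where \<open>r\<close> is positive is invariant, hence null or of full measure; in both cases \<open>r\<close> has
  constant sign almost everywhere, and its integral vanishes.
\<close>

lemma invariant_mean_zero:
  fixes r :: "'w \<Rightarrow> real"
  assumes r: "integrable M r" and inv: "AE x in M. r (T x) = r x" and mean: "(\<integral>x. r x \<partial>M) = 0"
  shows "AE x in M. r x = 0"
proof -
  have [measurable]: "r \<in> borel_measurable M" using r by auto
  have "AE x in M. T x \<in> {x \<in> space M. r x > 0} \<longleftrightarrow> x \<in> {x \<in> space M. r x > 0}"
    using inv AE_space by eventually_elim (simp add: T_space)
  then have "(AE x in M. x \<in> {x \<in> space M. r x > 0}) \<or> (AE x in M. x \<notin> {x \<in> space M. r x > 0})"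
    by (intro invariant_set_trivial) auto
  then show ?thesis
  proof
    assume "AE x in M. x \<in> {x \<in> space M. r x > 0}"
    then have "AE x in M. 0 \<le> r x" by eventually_elim simp
    with integral_nonneg_eq_0_iff_AE[OF r] mean show ?thesis by simp
  next
    assume "AE x in M. x \<notin> {x \<in> space M. r x > 0}"
    then have "AE x in M. 0 \<le> - r x" using AE_space by eventually_elim auto
    moreover have "integrable M (\<lambda>x. - r x)" "(\<integral>x. - r x \<partial>M) = 0" using r mean by auto
    ultimately have "AE x in M. - r x = 0" using integral_nonneg_eq_0_iff_AE by blast
    then show ?thesis by simp
  qed
qed

text \<open>
  A form of the mean ergodic theorem. Project \<open>g\<close> almost orthogonally onto the space \<open>W\<close> of coboundaries
  \<open>u \<circ> T - u\<close> by the almost representation of functionals; the residues are \<open>r m\<close>. Two facts follow from almost orthogonality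
  of \<open>r m\<close> to \<open>W\<close>. The difference of two residues lies in \<open>W\<close>, so the residues form a Cauchy sequence.
  The coboundary of \<open>r m\<close> itself lies in \<open>W\<close> and has square norm \<open>- 2 * \<integral> r m * (r m \<circ> T - r m)\<close>, so it
  tends to zero. The limit of the residues is therefore invariant with integral zero, and by
  ergodicity it is zero.
\<close>

lemma coboundary_approximation_bounded:
  assumes g: "g \<in> bounded_measurable" and mean: "(\<integral>x. g x \<partial>M) = 0" and eps: "\<epsilon> > 0"
  shows "\<exists>u\<in>bounded_measurable. (\<integral>x. \<bar>g x - (u (T x) - u x)\<bar> \<partial>M) < \<epsilon>"
proof -
  define D where "D u = (\<lambda>x. u (T x) - u x)" for u :: "'w \<Rightarrow> real"
  define W where "W = D ` bounded_measurable"
  have W_bdd: "W \<subseteq> bounded_measurable"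
  proof
    fix w assume "w \<in> W"
    then obtain u where u: "u \<in> bounded_measurable" "w = D u" by (auto simp: W_def)
    from bounded_measurable_combine[OF bounded_measurable_T[OF u(1)] u(1), of "-1"]
    show "w \<in> bounded_measurable" by (simp add: u(2) D_def)
  qed
  have W_lin: "(\<lambda>x. u x + s * v x) \<in> W" if "u \<in> W" "v \<in> W" for u v s
  proof -
    obtain u' v' where "u' \<in> bounded_measurable" "v' \<in> bounded_measurable" "u = D u'" "v = D v'"
      using \<open>u \<in> W\<close> \<open>v \<in> W\<close> by (auto simp: W_def)
    then show ?thesis
      unfolding W_def
      by (intro image_eqI[of _ _ "\<lambda>x. u' x + s * v' x"] bounded_measurable_combine)
         (auto simp: D_def algebra_simps)
  qed
  have prod_int: "integrable M (\<lambda>x. u x * v x)"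
    if "u \<in> bounded_measurable" "v \<in> bounded_measurable" for u v
    using that by (intro bounded_measurable_integrable bounded_measurable_mult)
  define nrm where "nrm v = sqrt (\<integral>x. (v x)\<^sup>2 \<partial>M)" for v :: "'w \<Rightarrow> real"
  have nrm2: "(nrm v)\<^sup>2 = (\<integral>x. v x * v x \<partial>M)" for v
    by (simp add: nrm_def power2_eq_square)
  have nrm0: "nrm v \<ge> 0" for v by (simp add: nrm_def)
  have L1_le: "(\<integral>x. \<bar>v x\<bar> \<partial>M) \<le> nrm v" if "v \<in> bounded_measurable" for v
    unfolding nrm_def using prod_int[OF that that] bounded_measurableD[OF that]
    by (intro integral_abs_le_sqrt_integral_square) (simp_all add: power2_eq_square)
  obtain B where B0: "B \<ge> 0" and B: "\<forall>x\<in>space M. \<bar>g x\<bar> \<le> B"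
    using bounded_measurable_bound[OF g] by blast
  have ex: "\<exists>w\<in>W. \<forall>v\<in>W. \<bar>(\<integral>x. g x * v x \<partial>M) - (\<integral>x. w x * v x \<partial>M)\<bar> \<le> 1 / real (Suc m) * nrm v" for m
    unfolding nrm_def
  proof (rule approximate_Riesz[where C=B])
    fix v assume "v \<in> W"
    then have v: "v \<in> bounded_measurable" using W_bdd by auto
    have "\<bar>\<integral>x. g x * v x \<partial>M\<bar> \<le> (\<integral>x. \<bar>g x * v x\<bar> \<partial>M)" by (rule integral_abs_bound)
    also have "\<dots> \<le> (\<integral>x. B * \<bar>v x\<bar> \<partial>M)"
    proof (rule integral_mono)
      show "\<bar>g x * v x\<bar> \<le> B * \<bar>v x\<bar>" if "x \<in> space M" for x
        using B that by (simp add: abs_mult mult_right_mono)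
    qed (use prod_int[OF g v] bounded_measurable_integrable[OF v] in auto)
    also have "\<dots> \<le> B * nrm v"
      using L1_le[OF v] B0 by (simp add: mult_left_mono)
    finally show "\<bar>\<integral>x. g x * v x \<partial>M\<bar> \<le> B * sqrt (\<integral>x. (v x)\<^sup>2 \<partial>M)"
      by (simp add: nrm_def)
  next
    fix u v s assume "u \<in> W" "v \<in> W"
    then have "u \<in> bounded_measurable" "v \<in> bounded_measurable" using W_bdd by auto
    then show "(\<integral>x. g x * (u x + s * v x) \<partial>M) = (\<integral>x. g x * u x \<partial>M) + s * (\<integral>x. g x * v x \<partial>M)"
      using prod_int[OF g, of u] prod_int[OF g, of v]
      by (simp add: distrib_left mult.left_commute[of _ s])
  next
    show "W \<noteq> {}" using g by (auto simp: W_def)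
    show "integrable M (\<lambda>x. u x * v x)" if "u \<in> W" "v \<in> W" for u v
      using that W_bdd by (intro prod_int) auto
  qed (use W_lin in auto)
  have "\<exists>w. \<forall>m. w m \<in> W \<and> (\<forall>v\<in>W.
      \<bar>(\<integral>x. g x * v x \<partial>M) - (\<integral>x. w m x * v x \<partial>M)\<bar> \<le> 1 / real (Suc m) * nrm v)"
    by (rule choice) (use ex in blast)
  then obtain w where wW: "\<And>m. w m \<in> W"
    and w: "\<And>m v. v \<in> W \<Longrightarrow>
      \<bar>(\<integral>x. g x * v x \<partial>M) - (\<integral>x. w m x * v x \<partial>M)\<bar> \<le> 1 / real (Suc m) * nrm v"
    by blast
  define r where "r m x = g x - w m x" for m x
  have wb: "w m \<in> bounded_measurable" for m using wW W_bdd by auto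
  have rb: "r m \<in> bounded_measurable" for m
    using bounded_measurable_combine[OF g wb, of "-1" m] by (simp add: r_def[abs_def])
  have orth: "\<bar>\<integral>x. r m x * v x \<partial>M\<bar> \<le> 1 / real (Suc m) * nrm v" if "v \<in> W" for m v
  proof -
    have "v \<in> bounded_measurable" using W_bdd that by auto
    then show ?thesis
      using w[OF that, of m] prod_int[OF g, of v] prod_int[OF wb, of v m]
      by (simp add: r_def left_diff_distrib)
  qed
  have div_le: "nrm v \<le> c" if "(nrm v)\<^sup>2 \<le> c * nrm v" "c \<ge> 0" for v c
    using that nrm0[of v] by (cases "nrm v = 0") (auto simp: power2_eq_square)
  have diff_W: "(\<lambda>x. r i x - r j x) \<in> W" for i j
    using W_lin[OF wW[of j] wW[of i], of "-1"] by (simp add: r_def)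
  \<comment> \<open>The square norm of the difference is the difference of its products with \<open>r i\<close> and \<open>r j\<close>, and each is small.\<close>
  have r_close: "nrm (\<lambda>x. r i x - r j x) \<le> 1 / real (Suc i) + 1 / real (Suc j)" for i j
  proof (rule div_le)
    define v where "v x = r i x - r j x" for x
    have v: "v \<in> W" "v \<in> bounded_measurable" using diff_W[of i j] W_bdd by (auto simp: v_def[abs_def])
    have "(nrm v)\<^sup>2 = (\<integral>x. r i x * v x - r j x * v x \<partial>M)"
      unfolding nrm2 by (simp add: v_def left_diff_distrib)
    also have "\<dots> = (\<integral>x. r i x * v x \<partial>M) - (\<integral>x. r j x * v x \<partial>M)"
      using prod_int[OF rb v(2)] by simp
    also have "\<dots> \<le> (1 / real (Suc i) + 1 / real (Suc j)) * nrm v"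
      using orth[OF v(1), of i] orth[OF v(1), of j] by (simp add: distrib_right)
    finally show "(nrm (\<lambda>x. r i x - r j x))\<^sup>2
      \<le> (1 / real (Suc i) + 1 / real (Suc j)) * nrm (\<lambda>x. r i x - r j x)"
      by (simp add: v_def[abs_def])
  qed simp
  have r_inv: "nrm (D (r m)) \<le> 2 / real (Suc m)" for m
  proof (rule div_le)
    have v: "D (r m) \<in> W" "D (r m) \<in> bounded_measurable" using rb W_bdd by (auto simp: W_def)
    have [measurable]: "r m \<in> borel_measurable M" using bounded_measurableD[OF rb] .
    note ints = prod_int[OF rb[of m] rb[of m]] prod_int[OF rb[of m] bounded_measurable_T[OF rb[of m]]]
      integrable_T[OF prod_int[OF rb[of m] rb[of m]]]
    have "(\<integral>x. r m (T x) * r m (T x) \<partial>M) = (\<integral>x. r m x * r m x \<partial>M)"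
      using integral_T[of "\<lambda>x. r m x * r m x"] by simp
    moreover have "(nrm (D (r m)))\<^sup>2
      = (\<integral>x. r m (T x) * r m (T x) + r m x * r m x - 2 * (r m x * r m (T x)) \<partial>M)"
      unfolding nrm2 by (simp add: D_def algebra_simps)
    moreover have "(\<integral>x. r m x * D (r m) x \<partial>M) = (\<integral>x. r m x * r m (T x) - r m x * r m x \<partial>M)"
      by (simp add: D_def algebra_simps)
    \<comment> \<open>Invariance of the measure makes the two square terms equal.\<close>
    ultimately have "(nrm (D (r m)))\<^sup>2 = - 2 * (\<integral>x. r m x * D (r m) x \<partial>M)"
      using ints by simp
    with orth[OF v(1), of m] show "(nrm (D (r m)))\<^sup>2 \<le> 2 / real (Suc m) * nrm (D (r m))"
      by simp
  qed simp
  have "integrable M (r m)" for m by (rule bounded_measurable_integrable[OF rb])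
  moreover have "\<exists>K. \<forall>i\<ge>K. \<forall>j\<ge>K. (\<integral>x. \<bar>r i x - r j x\<bar> \<partial>M) < e" if e: "e > 0" for e
  proof -
    obtain K where K: "1 / real (Suc K) < e / 2"
      using e reals_Archimedean[of "e/2"] by (auto simp: inverse_eq_divide)
    show ?thesis
    proof (intro exI allI impI)
      fix i j assume "K \<le> i" "K \<le> j"
      then have "1 / real (Suc i) \<le> 1 / real (Suc K)" "1 / real (Suc j) \<le> 1 / real (Suc K)"
        by (auto intro!: divide_left_mono)
      moreover have "(\<integral>x. \<bar>r i x - r j x\<bar> \<partial>M) \<le> nrm (\<lambda>x. r i x - r j x)"
        using L1_le[of "\<lambda>x. r i x - r j x"] diff_W W_bdd by auto
      ultimately show "(\<integral>x. \<bar>r i x - r j x\<bar> \<partial>M) < e"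
        using r_close[of i j] K by linarith
    qed
  qed
  ultimately obtain R where R: "integrable M R" and R_lim: "(\<lambda>n. \<integral>x. \<bar>r n x - R x\<bar> \<partial>M) \<longlonglongrightarrow> 0"
    using L1_Cauchy_limit[of M r] by blast
  have [measurable]: "R \<in> borel_measurable M" using R by auto
  have ri: "integrable M (r m)" for m by (rule bounded_measurable_integrable[OF rb])
  have [measurable]: "r m \<in> borel_measurable M" for m using ri by auto
  have "(\<integral>x. \<bar>R (T x) - R x\<bar> \<partial>M) \<le> 0"
  proof (rule LIMSEQ_le_const)
    have "(\<lambda>m. 1 / real (Suc m)) \<longlonglongrightarrow> 0" by (rule lim_1_over_n[THEN LIMSEQ_Suc])
    from tendsto_add[OF tendsto_mult_right_zero[OF R_lim, of 2] tendsto_mult_right_zero[OF this, of 2]]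
    show "(\<lambda>m. 2 * (\<integral>x. \<bar>r m x - R x\<bar> \<partial>M) + 2 * (1 / real (Suc m))) \<longlonglongrightarrow> 0" by simp
    show "\<exists>N. \<forall>m\<ge>N. (\<integral>x. \<bar>R (T x) - R x\<bar> \<partial>M) \<le> 2 * (\<integral>x. \<bar>r m x - R x\<bar> \<partial>M) + 2 * (1 / real (Suc m))"
    proof (intro exI[of _ 0] allI impI)
      fix m
      have "(\<integral>x. \<bar>R (T x) - R x\<bar> \<partial>M)
          \<le> (\<integral>x. \<bar>r m (T x) - R (T x)\<bar> + \<bar>D (r m) x\<bar> + \<bar>r m x - R x\<bar> \<partial>M)"
        using R ri integrable_T[OF R] integrable_T[OF ri]
        by (intro integral_mono) (auto simp: D_def)
      also have "\<dots> = (\<integral>x. \<bar>r m (T x) - R (T x)\<bar> \<partial>M) + (\<integral>x. \<bar>D (r m) x\<bar> \<partial>M) + (\<integral>x. \<bar>r m x - R x\<bar> \<partial>M)"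
        using R ri integrable_T[OF R] integrable_T[OF ri]
        by (simp add: D_def)
      also have "(\<integral>x. \<bar>r m (T x) - R (T x)\<bar> \<partial>M) = (\<integral>x. \<bar>r m x - R x\<bar> \<partial>M)"
        using integral_T[of "\<lambda>x. \<bar>r m x - R x\<bar>"] by simp
      also have "(\<integral>x. \<bar>D (r m) x\<bar> \<partial>M) \<le> 2 / real (Suc m)"
        using L1_le[OF subsetD[OF W_bdd, of "D (r m)"]] r_inv[of m] rb[of m]
        by (simp add: W_def)
      finally show "(\<integral>x. \<bar>R (T x) - R x\<bar> \<partial>M) \<le> 2 * (\<integral>x. \<bar>r m x - R x\<bar> \<partial>M) + 2 * (1 / real (Suc m))"
        by simp
    qed
  qed
  then have "(\<integral>x. \<bar>R (T x) - R x\<bar> \<partial>M) = 0" by (intro antisym integral_nonneg_AE) auto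
  then have R_inv: "AE x in M. R (T x) = R x"
    using integral_nonneg_eq_0_iff_AE[of M "\<lambda>x. \<bar>R (T x) - R x\<bar>"] R integrable_T[OF R] by auto
  have r_mean: "(\<integral>x. r m x \<partial>M) = 0" for m
  proof -
    obtain u where u: "u \<in> bounded_measurable" "w m = D u" using wW[of m] by (auto simp: W_def)
    have "(\<integral>x. w m x \<partial>M) = 0"
      using bounded_measurable_integrable[OF u(1)]
      unfolding u(2) D_def by (simp add: integrable_T integral_T)
    then show ?thesis
      using mean bounded_measurable_integrable[OF g] bounded_measurable_integrable[OF wb]
      by (simp add: r_def)
  qed
  have "\<bar>\<integral>x. R x \<partial>M\<bar> \<le> 0"
  proof (rule LIMSEQ_le_const[OF R_lim], intro exI allI impI)
    fix m
    have "\<bar>\<integral>x. R x \<partial>M\<bar> = \<bar>\<integral>x. r m x - R x \<partial>M\<bar>"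
      using R ri r_mean[of m] by simp
    also have "\<dots> \<le> (\<integral>x. \<bar>r m x - R x\<bar> \<partial>M)" by (rule integral_abs_bound)
    finally show "\<bar>\<integral>x. R x \<partial>M\<bar> \<le> (\<integral>x. \<bar>r m x - R x\<bar> \<partial>M)" .
  qed
  then have "(\<integral>x. R x \<partial>M) = 0" by simp
  from invariant_mean_zero[OF R R_inv this] have R0: "AE x in M. R x = 0" .
  have "(\<integral>x. \<bar>r m x - R x\<bar> \<partial>M) = (\<integral>x. \<bar>r m x\<bar> \<partial>M)" for m
    by (rule integral_cong_AE) (use R0 in auto)
  with R_lim have "(\<lambda>m. \<integral>x. \<bar>r m x\<bar> \<partial>M) \<longlonglongrightarrow> 0" by simp
  then have "eventually (\<lambda>m. (\<integral>x. \<bar>r m x\<bar> \<partial>M) < \<epsilon>) sequentially"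
    using eps by (rule order_tendstoD(2))
  then obtain m where m: "(\<integral>x. \<bar>r m x\<bar> \<partial>M) < \<epsilon>" by (auto simp: eventually_sequentially)
  obtain u where "u \<in> bounded_measurable" "w m = D u" using wW[of m] by (auto simp: W_def)
  with m show ?thesis by (auto simp: r_def D_def)
qed

end

context ergodic_system
begin

lemma coboundary_approximation:
  assumes g: "integrable M g" and eps: "\<epsilon> > 0"
  shows "\<exists>u\<in>bounded_measurable. (\<integral>x. \<bar>g x - (\<integral>y. g y \<partial>M) - (u (T x) - u x)\<bar> \<partial>M) < \<epsilon>"
proof -
  obtain b where b: "b \<in> bounded_measurable" and gb: "(\<integral>x. \<bar>g x - b x\<bar> \<partial>M) < \<epsilon> / 3"
    using bounded_measurable_dense[OF g, of "\<epsilon>/3"] eps by auto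
  define m where "m = (\<integral>x. b x \<partial>M)"
  have bi: "integrable M b" by (rule bounded_measurable_integrable[OF b])
  have b0: "(\<lambda>x. b x - m) \<in> bounded_measurable"
    using bounded_measurable_combine[OF b bounded_measurable_const[of 1], of "- m"] by simp
  have "(\<integral>x. b x - m \<partial>M) = 0"
    using bi by (simp add: m_def prob_space)
  from coboundary_approximation_bounded[OF b0 this, of "\<epsilon>/3"] eps
  obtain u where u: "u \<in> bounded_measurable" and bu: "(\<integral>x. \<bar>b x - m - (u (T x) - u x)\<bar> \<partial>M) < \<epsilon> / 3"
    by auto
  have ui: "integrable M u" "integrable M (\<lambda>x. u (T x))"
    using bounded_measurable_integrable[OF u] bounded_measurable_integrable[OF bounded_measurable_T[OF u]] .
  have "\<bar>(\<integral>y. g y \<partial>M) - m\<bar> = \<bar>\<integral>x. g x - b x \<partial>M\<bar>"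
    using g bi by (simp add: m_def)
  also have "\<dots> \<le> (\<integral>x. \<bar>g x - b x\<bar> \<partial>M)" by (rule integral_abs_bound)
  finally have mean: "\<bar>(\<integral>y. g y \<partial>M) - m\<bar> < \<epsilon> / 3" using gb by simp
  have "(\<integral>x. \<bar>g x - (\<integral>y. g y \<partial>M) - (u (T x) - u x)\<bar> \<partial>M)
      \<le> (\<integral>x. \<bar>g x - b x\<bar> + \<bar>b x - m - (u (T x) - u x)\<bar> + \<bar>(\<integral>y. g y \<partial>M) - m\<bar> \<partial>M)"
    using g bi ui by (intro integral_mono) auto
  also have "\<dots> = (\<integral>x. \<bar>g x - b x\<bar> \<partial>M) + (\<integral>x. \<bar>b x - m - (u (T x) - u x)\<bar> \<partial>M) + \<bar>(\<integral>y. g y \<partial>M) - m\<bar>"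
    using g bi ui by (simp add: prob_space)
  also have "\<dots> < \<epsilon>" using gb bu mean by simp
  finally show ?thesis using u by blast
qed

text \<open>
  A bounded sequence that is asymptotically invariant need not approach constants in norm, but it
  does so weakly. Up to a small error in \<open>L\<^sub>1\<close>, \<open>g\<close> minus its mean is a coboundary \<open>u \<circ> T - u\<close>, and by
  invariance of the measure the integral of \<open>t n * (u \<circ> T - u)\<close> equals that of
  \<open>(t n - t n \<circ> T) * (u \<circ> T)\<close>.
\<close>

lemma asymptotically_invariant_decorrelates:
  fixes t :: "nat \<Rightarrow> 'w \<Rightarrow> real"
  assumes meas[measurable]: "\<And>n. t n \<in> borel_measurable M"
    and le1: "\<And>n x. \<bar>t n x\<bar> \<le> 1"
    and inv: "(\<lambda>n. \<integral>x. \<bar>t n (T x) - t n x\<bar> \<partial>M) \<longlonglongrightarrow> 0"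
    and g: "integrable M g"
  shows "(\<lambda>n. (\<integral>x. t n x * g x \<partial>M) - (\<integral>x. t n x \<partial>M) * (\<integral>x. g x \<partial>M)) \<longlonglongrightarrow> 0"
proof (rule LIMSEQ_I)
  fix e :: real assume e: "e > 0"
  define m where "m = (\<integral>x. g x \<partial>M)"
  obtain u where u: "u \<in> bounded_measurable"
    and gu: "(\<integral>x. \<bar>g x - m - (u (T x) - u x)\<bar> \<partial>M) < e / 2"
    using coboundary_approximation[OF g, of "e/2"] e unfolding m_def by auto
  obtain B where B: "B \<ge> 0" "\<forall>x\<in>space M. \<bar>u x\<bar> \<le> B"
    using bounded_measurable_bound[OF u] by blast
  note uT = bounded_measurable_T[OF u]
  have ui: "integrable M u" "integrable M (\<lambda>x. u (T x))"
    using bounded_measurable_integrable[OF u] bounded_measurable_integrable[OF uT] .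
  have [measurable]: "u \<in> borel_measurable M" using ui by simp
  have tb: "t n \<in> bounded_measurable" for n by (rule bounded_measurableI[OF meas le1])
  note tTb = bounded_measurable_T[OF tb]
  have ti: "integrable M (\<lambda>x. t n x * k x)" if "integrable M k" for n k
    by (rule bounded_measurable_integrable_mult[OF tb that])
  have t1: "integrable M (t n)" "integrable M (\<lambda>x. t n (T x))" for n
    using bounded_measurable_integrable[OF tb] bounded_measurable_integrable[OF tTb] .
  have main: "\<bar>(\<integral>x. t n x * g x \<partial>M) - (\<integral>x. t n x \<partial>M) * m\<bar> \<le> e / 2 + B * (\<integral>x. \<bar>t n (T x) - t n x\<bar> \<partial>M)" for n
  proof -
    let ?R = "\<lambda>x. g x - m - (u (T x) - u x)"
    have Ri: "integrable M ?R" using g ui by simp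
    have "\<bar>\<integral>x. t n x * ?R x \<partial>M\<bar> \<le> (\<integral>x. \<bar>t n x * ?R x\<bar> \<partial>M)" by (rule integral_abs_bound)
    also have "\<dots> \<le> (\<integral>x. \<bar>?R x\<bar> \<partial>M)"
    proof (rule integral_mono)
      show "\<bar>t n x * ?R x\<bar> \<le> \<bar>?R x\<bar>" for x
        unfolding abs_mult using mult_right_mono[OF le1[of n x], of "\<bar>?R x\<bar>"] by simp
    qed (intro integrable_abs ti Ri)+
    finally have R: "\<bar>\<integral>x. t n x * ?R x \<partial>M\<bar> \<le> e / 2" using gu by simp
    have "(\<integral>x. t n x * u x \<partial>M) = (\<integral>x. t n (T x) * u (T x) \<partial>M)"
      using integral_T[of "\<lambda>x. t n x * u x"] by simp
    then have "\<bar>(\<integral>x. t n x * u (T x) \<partial>M) - (\<integral>x. t n x * u x \<partial>M)\<bar>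
        = \<bar>\<integral>x. t n x * u (T x) - t n (T x) * u (T x) \<partial>M\<bar>"
      using ti[OF ui(2)] bounded_measurable_integrable_mult[OF tTb ui(2)] by simp
    also have "\<dots> \<le> (\<integral>x. \<bar>t n x * u (T x) - t n (T x) * u (T x)\<bar> \<partial>M)" by (rule integral_abs_bound)
    also have "\<dots> \<le> (\<integral>x. B * \<bar>t n (T x) - t n x\<bar> \<partial>M)"
    proof (rule integral_mono)
      fix x assume "x \<in> space M"
      then have "\<bar>u (T x)\<bar> \<le> B" using B T_space by blast
      moreover have "\<bar>t n x * u (T x) - t n (T x) * u (T x)\<bar> = \<bar>u (T x)\<bar> * \<bar>t n (T x) - t n x\<bar>"
        by (subst abs_minus_commute) (simp add: abs_mult[symmetric] algebra_simps)
      ultimately show "\<bar>t n x * u (T x) - t n (T x) * u (T x)\<bar> \<le> B * \<bar>t n (T x) - t n x\<bar>"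
        by (simp add: mult_right_mono)
    qed (use t1 ti[OF ui(2)] bounded_measurable_integrable_mult[OF tTb ui(2)] in simp_all)
    finally have U: "\<bar>(\<integral>x. t n x * u (T x) \<partial>M) - (\<integral>x. t n x * u x \<partial>M)\<bar> \<le> B * (\<integral>x. \<bar>t n (T x) - t n x\<bar> \<partial>M)"
      by simp
    have "(\<integral>x. t n x * ?R x \<partial>M)
        = (\<integral>x. t n x * g x - m * t n x - (t n x * u (T x) - t n x * u x) \<partial>M)"
      by (simp add: algebra_simps)
    also have "\<dots> = (\<integral>x. t n x * g x \<partial>M) - m * (\<integral>x. t n x \<partial>M)
        - ((\<integral>x. t n x * u (T x) \<partial>M) - (\<integral>x. t n x * u x \<partial>M))"
      using ti[OF g] ti[OF ui(1)] ti[OF ui(2)] t1 by simp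
    finally show ?thesis
      using R U by (subst mult.commute[of "\<integral>x. t n x \<partial>M" m]) linarith
  qed
  have "(\<lambda>n. B * (\<integral>x. \<bar>t n (T x) - t n x\<bar> \<partial>M)) \<longlonglongrightarrow> 0"
    using tendsto_mult_right_zero[OF inv] .
  then have "eventually (\<lambda>n. B * (\<integral>x. \<bar>t n (T x) - t n x\<bar> \<partial>M) < e / 2) sequentially"
    using e by (intro order_tendstoD(2)) auto
  then obtain K where K: "\<And>n. n \<ge> K \<Longrightarrow> B * (\<integral>x. \<bar>t n (T x) - t n x\<bar> \<partial>M) < e / 2"
    by (auto simp: eventually_sequentially)
  show "\<exists>K. \<forall>n\<ge>K. norm ((\<integral>x. t n x * g x \<partial>M) - (\<integral>x. t n x \<partial>M) * (\<integral>x. g x \<partial>M) - 0) < e"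
  proof (intro exI allI impI)
    fix n assume "n \<ge> K"
    with main[of n] K[of n] show "norm ((\<integral>x. t n x * g x \<partial>M) - (\<integral>x. t n x \<partial>M) * (\<integral>x. g x \<partial>M) - 0) < e"
      by (simp add: m_def)
  qed
qed

end

section \<open>Functionals on multiples of a fixed function\<close>

text \<open>
  This replaces the description of the dual of \<open>L\<^sub>1\<close> as \<open>L\<^sub>\<infinity>\<close>. Along the multiples \<open>u *\<^sub>R f\<close> with bounded
  \<open>u\<close>, the functional is bounded by a multiple of the \<open>L\<^sub>1\<close> norm of \<open>u\<close> for the probability measure with
  density \<open>norm f / \<integral> norm f\<close>, and so also by its \<open>L\<^sub>2\<close> norm. Hence it is given, up to a small
  error, by integration against a bounded function.
\<close>

lemma (in invertible_system) functional_tendsto_zero: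
  fixes L :: "('w \<Rightarrow> 'b::{banach, second_countable_topology}) \<Rightarrow> real" and t :: "nat \<Rightarrow> 'w \<Rightarrow> real"
  assumes add: "\<And>f g. integrable M f \<Longrightarrow> integrable M g \<Longrightarrow> L (\<lambda>x. f x + g x) = L f + L g"
    and scale: "\<And>c f. integrable M f \<Longrightarrow> L (\<lambda>x. c *\<^sub>R f x) = c * L f"
    and bound: "\<And>f. integrable M f \<Longrightarrow> \<bar>L f\<bar> \<le> K * (\<integral>x. norm (f x) \<partial>M)"
    and meas[measurable]: "\<And>n. t n \<in> borel_measurable M"
    and le1: "\<And>n x. \<bar>t n x\<bar> \<le> 1"
    and lim: "\<And>g. integrable M g \<Longrightarrow> (\<lambda>n. \<integral>x. t n x * g x \<partial>M) \<longlonglongrightarrow> 0"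
    and f: "integrable M f"
  shows "(\<lambda>n. L (\<lambda>x. t n x *\<^sub>R f x)) \<longlonglongrightarrow> 0"
proof -
  have [measurable]: "f \<in> borel_measurable M" using f by auto
  define m where "m = (\<integral>x. norm (f x) \<partial>M)"
  have tb: "t n \<in> bounded_measurable" for n by (rule bounded_measurableI[OF meas le1])
  have vf: "integrable M (\<lambda>x. v x *\<^sub>R f x)" if "v \<in> bounded_measurable" for v
    by (rule bounded_measurable_integrable_scaleR[OF that f])
  have "m \<ge> 0" unfolding m_def by simp
  then consider "m = 0" | "m > 0" by linarith
  then show ?thesis
  proof cases
    case 1
    then have "AE x in M. f x = 0"
      using integral_nonneg_eq_0_iff_AE[of M "\<lambda>x. norm (f x)"] f by (auto simp: m_def)
    then have "(\<integral>x. norm (t n x *\<^sub>R f x) \<partial>M) = 0" for n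
      by (intro integral_eq_zero_AE) auto
    then have "L (\<lambda>x. t n x *\<^sub>R f x) = 0" for n
      using bound[OF vf[OF tb[of n]]] by simp
    then show ?thesis by simp
  next
    case 2
    define w where "w x = norm (f x) / m" for x
    have w[measurable]: "w \<in> borel_measurable M" unfolding w_def by measurable
    have w0: "w x \<ge> 0" for x using 2 by (simp add: w_def)
    have wi: "integrable M w" unfolding w_def using f by simp
    have w1: "(\<integral>x. w x \<partial>M) = 1" using 2 by (simp add: w_def m_def)
    define N where "N = density M (\<lambda>x. ennreal (w x))"
    have meas_N: "borel_measurable N = borel_measurable M" by (simp add: N_def cong: measurable_cong_sets)
    interpret N: prob_space N
    proof
      have "emeasure N (space N) = (\<integral>\<^sup>+x. ennreal (w x) \<partial>M)"
        by (simp add: N_def emeasure_density cong: nn_integral_cong)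
      also have "\<dots> = 1" using nn_integral_eq_integral[OF wi] w0 w1 by simp
      finally show "emeasure N (space N) = 1" .
    qed
    have N_int: "integrable N v" if "v \<in> bounded_measurable" for v
      unfolding N_def using bounded_measurable_integrable_mult[OF that wi] bounded_measurableD[OF that] w0
      by (subst integrable_density) (auto simp: mult.commute)
    have N_eq: "(\<integral>x. v x \<partial>N) = (\<integral>x. v x * w x \<partial>M)" if "v \<in> borel_measurable M" for v :: "'w \<Rightarrow> real"
      unfolding N_def using that w0
      by (subst integral_density) (auto simp: mult.commute)
    show ?thesis
    proof (rule LIMSEQ_I)
      fix e :: real assume e: "e > 0"
      have "\<exists>u\<in>bounded_measurable. \<forall>v\<in>bounded_measurable.
        \<bar>L (\<lambda>x. v x *\<^sub>R f x) - (\<integral>x. u x * v x \<partial>N)\<bar> \<le> e / 2 * sqrt (\<integral>x. (v x)\<^sup>2 \<partial>N)"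
      proof (rule approximate_Riesz[where C="\<bar>K\<bar> * m"])
        show "integrable N (\<lambda>x. u x * v x)" if "u \<in> bounded_measurable" "v \<in> bounded_measurable" for u v
          by (rule N_int[OF bounded_measurable_mult[OF that]])
        show "bounded_measurable \<noteq> {}" using bounded_measurable_const by blast
      next
        fix u v :: "'w \<Rightarrow> real" and s
        assume "u \<in> bounded_measurable" "v \<in> bounded_measurable"
        note ints = vf[OF this(1)] vf[OF this(2)]
        have "L (\<lambda>x. (u x + s * v x) *\<^sub>R f x) = L (\<lambda>x. u x *\<^sub>R f x + s *\<^sub>R (v x *\<^sub>R f x))"
          by (simp add: scaleR_add_left)
        also have "\<dots> = L (\<lambda>x. u x *\<^sub>R f x) + s * L (\<lambda>x. v x *\<^sub>R f x)"
          by (simp only: add[OF ints(1) integrable_scaleR_right[OF ints(2)]] scale[OF ints(2)])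
        finally show "L (\<lambda>x. (u x + s * v x) *\<^sub>R f x) = L (\<lambda>x. u x *\<^sub>R f x) + s * L (\<lambda>x. v x *\<^sub>R f x)" .
      next
        fix v assume v: "v \<in> bounded_measurable"
        have [measurable]: "v \<in> borel_measurable M" by (rule bounded_measurableD[OF v])
        have "\<bar>L (\<lambda>x. v x *\<^sub>R f x)\<bar> \<le> K * (\<integral>x. norm (v x *\<^sub>R f x) \<partial>M)"
          by (rule bound[OF vf[OF v]])
        also have "\<dots> \<le> \<bar>K\<bar> * (\<integral>x. norm (v x *\<^sub>R f x) \<partial>M)"
          by (intro mult_right_mono) auto
        also have "(\<integral>x. norm (v x *\<^sub>R f x) \<partial>M) = m * (\<integral>x. \<bar>v x\<bar> \<partial>N)"
          using 2 by (simp add: N_eq w_def)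
        also have "\<bar>K\<bar> * (m * (\<integral>x. \<bar>v x\<bar> \<partial>N)) \<le> \<bar>K\<bar> * (m * sqrt (\<integral>x. (v x)\<^sup>2 \<partial>N))"
          using 2 N_int[OF bounded_measurable_mult[OF v v]] bounded_measurableD[OF v]
          by (intro mult_left_mono N.integral_abs_le_sqrt_integral_square) (auto simp: meas_N power2_eq_square)
        finally show "\<bar>L (\<lambda>x. v x *\<^sub>R f x)\<bar> \<le> \<bar>K\<bar> * m * sqrt (\<integral>x. (v x)\<^sup>2 \<partial>N)"
          by (simp add: mult.assoc)
      qed (use e bounded_measurable_combine in auto)
      then obtain u where u: "u \<in> bounded_measurable" and approx: "\<And>v. v \<in> bounded_measurable \<Longrightarrow>
        \<bar>L (\<lambda>x. v x *\<^sub>R f x) - (\<integral>x. u x * v x \<partial>N)\<bar> \<le> e / 2 * sqrt (\<integral>x. (v x)\<^sup>2 \<partial>N)"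
        by blast
      have [measurable]: "u \<in> borel_measurable M" by (rule bounded_measurableD[OF u])
      have "(\<lambda>n. \<integral>x. t n x * (u x * w x) \<partial>M) \<longlonglongrightarrow> 0"
        by (rule lim[OF bounded_measurable_integrable_mult[OF u wi]])
      then have "eventually (\<lambda>n. \<bar>\<integral>x. t n x * (u x * w x) \<partial>M\<bar> < e / 2) sequentially"
        using e by (intro order_tendstoD(2)[OF tendsto_rabs_zero]) auto
      then obtain n0 where n0: "\<And>n. n \<ge> n0 \<Longrightarrow> \<bar>\<integral>x. t n x * (u x * w x) \<partial>M\<bar> < e / 2"
        by (auto simp: eventually_sequentially)
      show "\<exists>n0. \<forall>n\<ge>n0. norm (L (\<lambda>x. t n x *\<^sub>R f x) - 0) < e"
      proof (intro exI allI impI)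
        fix n assume n: "n \<ge> n0"
        have "(\<integral>x. (t n x)\<^sup>2 \<partial>N) \<le> (\<integral>x. 1 \<partial>N)"
          using N_int[OF bounded_measurable_mult[OF tb tb]] le1
          by (intro integral_mono) (auto simp: power2_eq_square abs_square_le_1[unfolded power2_eq_square])
        then have "sqrt (\<integral>x. (t n x)\<^sup>2 \<partial>N) \<le> 1" by (simp add: N.prob_space)
        then have "e / 2 * sqrt (\<integral>x. (t n x)\<^sup>2 \<partial>N) \<le> e / 2"
          using e by (simp add: mult_left_le)
        moreover have "(\<integral>x. u x * t n x \<partial>N) = (\<integral>x. t n x * (u x * w x) \<partial>M)"
          by (subst N_eq) (auto simp: mult_ac)
        ultimately show "norm (L (\<lambda>x. t n x *\<^sub>R f x) - 0) < e"
          using approx[OF tb[of n]] n0[OF n] unfolding real_norm_def by linarith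
      qed
    qed
  qed
qed

text \<open>
  The factor \<open>C\<close> depends on the point in no controlled way, so the bound gives no estimate of the
  integrals. It does transfer almost everywhere convergence along subsequences, and for
  uniformly bounded functions that suffices by dominated convergence.
\<close>

lemma (in finite_measure) L1_tendsto_zero_of_pointwise_bound:
  fixes \<Delta> :: "nat \<Rightarrow> 'a \<Rightarrow> real"
  assumes meas[measurable]: "\<And>n. \<Delta> n \<in> borel_measurable M"
    and bdd: "\<And>n x. \<bar>\<Delta> n x\<bar> \<le> B"
    and E: "\<And>n. integrable M (E n)" and E0: "(\<lambda>n. \<integral>x. \<bar>E n x\<bar> \<partial>M) \<longlonglongrightarrow> 0"
    and le: "AE x in M. \<exists>C. \<forall>n. \<bar>\<Delta> n x\<bar> \<le> C * \<bar>E n x\<bar>"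
  shows "(\<lambda>n. \<integral>x. \<bar>\<Delta> n x\<bar> \<partial>M) \<longlonglongrightarrow> 0"
proof (rule ccontr)
  assume "\<not> ?thesis"
  then obtain e where e: "e > 0" and freq: "\<forall>K. \<exists>n\<ge>K. \<not> (\<integral>x. \<bar>\<Delta> n x\<bar> \<partial>M) < e"
    by (auto simp: lim_sequentially dist_real_def)
  have "infinite {n. \<not> (\<integral>x. \<bar>\<Delta> n x\<bar> \<partial>M) < e}"
    unfolding infinite_nat_iff_unbounded_le using freq by auto
  then obtain r :: "nat \<Rightarrow> nat" where r: "strict_mono r" "\<And>n. r n \<in> {n. \<not> (\<integral>x. \<bar>\<Delta> n x\<bar> \<partial>M) < e}"
    using infinite_enumerate by blast
  have "(\<lambda>n. \<integral>x. norm (E (r n) x) \<partial>M) \<longlonglongrightarrow> 0"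
    using LIMSEQ_subseq_LIMSEQ[OF E0 r(1)] by (simp add: o_def)
  from tendsto_L1_AE_subseq[of M "\<lambda>n. E (r n)", OF E this]
  obtain r' :: "nat \<Rightarrow> nat" where r': "strict_mono r'" and AE0: "AE x in M. (\<lambda>n. E (r (r' n)) x) \<longlonglongrightarrow> 0"
    by auto
  have "(\<lambda>n. \<integral>x. \<bar>\<Delta> (r (r' n)) x\<bar> \<partial>M) \<longlonglongrightarrow> (\<integral>x. 0 \<partial>M)"
  proof (rule integral_dominated_convergence[where w="\<lambda>x. B"])
    show "AE x in M. (\<lambda>n. \<bar>\<Delta> (r (r' n)) x\<bar>) \<longlonglongrightarrow> 0"
      using AE0 le
    proof eventually_elim
      case (elim x)
      then obtain C where C: "\<And>n. \<bar>\<Delta> n x\<bar> \<le> C * \<bar>E n x\<bar>" by blast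
      show ?case
      proof (rule tendsto_sandwich[OF _ _ tendsto_const])
        show "(\<lambda>n. C * \<bar>E (r (r' n)) x\<bar>) \<longlonglongrightarrow> 0"
          using tendsto_mult_right_zero[OF tendsto_rabs_zero[OF elim(1)]] .
      qed (use C in auto)
    qed
  qed (use bdd in auto)
  then have "eventually (\<lambda>n. (\<integral>x. \<bar>\<Delta> (r (r' n)) x\<bar> \<partial>M) < e) sequentially"
    using e by (intro order_tendstoD(2)) auto
  then show False using r(2) by (auto simp: eventually_sequentially)
qed

section \<open>Nonnegative series as integrals over the counting measure\<close>

text \<open>
  Passing to the extended nonnegative reals gives measurability of series with parameters and allows
  Tonelli's theorem. The second equation also covers divergent series, where both sides are \<open>0\<close>.
\<close>

lemma summable_on_count_space:
  fixes c :: "'i \<Rightarrow> real"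
  assumes "\<And>k. c k \<ge> 0"
  shows "c summable_on UNIV \<longleftrightarrow> (\<integral>\<^sup>+k. ennreal (c k) \<partial>count_space UNIV) < \<infinity>"
    and "infsum c UNIV = enn2real (\<integral>\<^sup>+k. ennreal (c k) \<partial>count_space UNIV)"
proof -
  have *: "c summable_on UNIV \<longleftrightarrow> integrable (count_space UNIV) c"
    using abs_summable_equivalent[of c UNIV] assms by (simp add: Infinite_Set_Sum.abs_summable_on_def)
  show "c summable_on UNIV \<longleftrightarrow> (\<integral>\<^sup>+k. ennreal (c k) \<partial>count_space UNIV) < \<infinity>"
    unfolding * using assms by (simp add: integrable_iff_bounded)
  have eq: "(\<integral>k. c k \<partial>count_space UNIV) = enn2real (\<integral>\<^sup>+k. ennreal (c k) \<partial>count_space UNIV)"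
    using assms by (intro integral_eq_nn_integral) auto
  show "infsum c UNIV = enn2real (\<integral>\<^sup>+k. ennreal (c k) \<partial>count_space UNIV)"
  proof (cases "c summable_on UNIV")
    case True
    then show ?thesis
      using infsetsum_infsum[of c UNIV] * eq
      by (simp add: infsetsum_def Infinite_Set_Sum.abs_summable_on_def)
  next
    case False
    then show ?thesis
      using eq * by (simp add: infsum_not_exists not_integrable_integral_eq)
  qed
qed

lemma nn_integral_count_space_int:
  "(\<integral>\<^sup>+k. c k \<partial>count_space UNIV) = (\<Sum>j. c (int_decode j))" for c :: "int \<Rightarrow> ennreal"
  using nn_integral_bij_count_space[OF bij_int_decode, of c]
  by (simp add: nn_integral_count_space_nat)

lemma borel_measurable_infsum_int:
  fixes c :: "int \<Rightarrow> 'a \<Rightarrow> real"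
  assumes [measurable]: "\<And>k. c k \<in> borel_measurable M" and "\<And>k x. c k x \<ge> 0"
  shows "(\<lambda>x. \<Sum>\<^sub>\<infinity>k. c k x) \<in> borel_measurable M"
  using assms(2) by (simp add: summable_on_count_space(2) nn_integral_count_space_int)

lemma infsum_square_le:
  fixes c :: "'i \<Rightarrow> real"
  assumes nonneg: "\<And>k. c k \<ge> 0" and c: "c summable_on UNIV"
  shows "(\<lambda>k. (c k)\<^sup>2) summable_on UNIV" and "(\<Sum>\<^sub>\<infinity>k. (c k)\<^sup>2) \<le> (\<Sum>\<^sub>\<infinity>k. c k)\<^sup>2"
proof -
  define S where "S = (\<Sum>\<^sub>\<infinity>k. c k)"
  have le: "c k \<le> S" for k
    using finite_sum_le_infsum[OF c, of "{k}"] nonneg by (simp add: S_def)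
  have sq: "(c k)\<^sup>2 \<le> S * c k" for k
    using le[of k] nonneg[of k] by (simp add: power2_eq_square mult_right_mono)
  have Sc: "(\<lambda>k. S * c k) summable_on UNIV" by (rule summable_on_cmult_right[OF c])
  show *: "(\<lambda>k. (c k)\<^sup>2) summable_on UNIV"
    by (rule summable_on_comparison_test[OF Sc]) (use sq in auto)
  have "(\<Sum>\<^sub>\<infinity>k. (c k)\<^sup>2) \<le> (\<Sum>\<^sub>\<infinity>k. S * c k)"
    using sq by (intro infsum_mono * Sc) auto
  also have "\<dots> = S\<^sup>2" by (simp add: infsum_cmult_right' S_def power2_eq_square)
  finally show "(\<Sum>\<^sub>\<infinity>k. (c k)\<^sup>2) \<le> (\<Sum>\<^sub>\<infinity>k. c k)\<^sup>2" by (simp add: S_def)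
qed

section \<open>Integer iterates and orbits\<close>

context invertible_system
begin

abbreviation iterate :: "int \<Rightarrow> 'w \<Rightarrow> 'w" where
  "iterate \<equiv> int_iterate (space M) T"

lemma inv_T: "x \<in> space M \<Longrightarrow> inv_into (space M) T (T x) = x"
  using invertible by (auto simp: invertible_mpt_def bij_betw_def)

lemma iterate_0: "iterate 0 x = x"
  by (simp add: int_iterate_def)

lemma iterate_T:
  assumes "x \<in> space M"
  shows "iterate k (T x) = iterate (k + 1) x"
proof (cases "k \<ge> 0")
  case True
  then show ?thesis by (simp add: int_iterate_def nat_add_distrib funpow_swap1)
next
  case False
  define m where "m = nat (- k - 1)"
  have k: "nat (- k) = Suc m" "k + 1 = - int m" using False by (auto simp: m_def)
  have "iterate k (T x) = (inv_into (space M) T ^^ m) x"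
    using False assms by (simp add: int_iterate_def k funpow_Suc_right inv_T del: funpow.simps)
  then show ?thesis by (simp add: int_iterate_def k(2))
qed

lemma distr_funpow:
  assumes "R \<in> M \<rightarrow>\<^sub>M M" "distr M M R = M"
  shows "R ^^ n \<in> M \<rightarrow>\<^sub>M M \<and> distr M M (R ^^ n) = M"
proof (induction n)
  case 0
  then show ?case using distr_id by (simp add: id_def)
next
  case (Suc n)
  have "distr M M (R ^^ Suc n) = distr (distr M M (R ^^ n)) M R"
    using Suc assms by (subst distr_distr) auto
  then show ?case using Suc assms by (auto intro: measurable_comp simp: comp_def)
qed

lemma distr_inv_T: "distr M M (inv_into (space M) T) = M"
proof -
  have [measurable]: "inv_into (space M) T \<in> M \<rightarrow>\<^sub>M M"
    using invertible by (simp add: invertible_mpt_def)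
  have "distr M M (inv_into (space M) T) = distr (distr M M T) M (inv_into (space M) T)"
    by (simp add: distr_T)
  also have "\<dots> = distr M M (inv_into (space M) T \<circ> T)"
    by (rule distr_distr) auto
  also have "\<dots> = distr M M id"
    by (rule distr_cong) (auto simp: inv_T)
  finally show ?thesis using distr_id by (simp add: id_def)
qed

lemma iterate_measure_preserving: "iterate k \<in> M \<rightarrow>\<^sub>M M" "distr M M (iterate k) = M"
proof -
  have "inv_into (space M) T \<in> M \<rightarrow>\<^sub>M M"
    using invertible by (simp add: invertible_mpt_def)
  note S = distr_funpow[OF this distr_inv_T]
  show "iterate k \<in> M \<rightarrow>\<^sub>M M" "distr M M (iterate k) = M"
    using S distr_funpow[OF measurable_T distr_T]
    by (auto simp: int_iterate_def[abs_def])
qed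

lemma measurable_iterate[measurable]: "iterate k \<in> M \<rightarrow>\<^sub>M M"
  by (rule iterate_measure_preserving)

lemma nn_integral_iterate:
  assumes [measurable]: "f \<in> borel_measurable M"
  shows "(\<integral>\<^sup>+x. f (iterate k x) \<partial>M) = (\<integral>\<^sup>+x. f x \<partial>M)"
  using nn_integral_distr[of "iterate k" M M f] by (simp add: iterate_measure_preserving(2))

end

text \<open>
  The points whose orbit avoids the support of \<open>f\<close> form a strictly invariant set, and it is contained
  in the zero set of \<open>f\<close>.
\<close>

lemma (in ergodic_system) AE_orbit_meets_support:
  fixes f :: "'w \<Rightarrow> 'b::{real_normed_vector, second_countable_topology}"
  assumes [measurable]: "f \<in> borel_measurable M" and "\<not> (AE x in M. f x = 0)"
  shows "AE x in M. \<exists>k. f (iterate k x) \<noteq> 0"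
proof -
  define A where "A = {x \<in> space M. \<forall>k. f (iterate k x) = 0}"
  have [measurable]: "A \<in> sets M" unfolding A_def by measurable
  have "T x \<in> A \<longleftrightarrow> x \<in> A" if x: "x \<in> space M" for x
  proof -
    have "(\<forall>k. f (iterate k (T x)) = 0) \<longleftrightarrow> (\<forall>k. f (iterate k x) = 0)"
      unfolding iterate_T[OF x] by (metis diff_add_cancel)
    then show ?thesis using x T_space by (simp add: A_def)
  qed
  then have "(AE x in M. x \<in> A) \<or> (AE x in M. x \<notin> A)"
    by (intro invariant_set_trivial) auto
  moreover have "\<not> (AE x in M. x \<in> A)"
  proof
    assume "AE x in M. x \<in> A"
    then have "AE x in M. f x = 0"
      by eventually_elim (auto simp: A_def dest: spec[of _ 0] simp: iterate_0)
    with assms(2) show False by simp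
  qed
  ultimately have "AE x in M. x \<notin> A" by blast
  then show ?thesis using AE_space by eventually_elim (auto simp: A_def)
qed

section \<open>The integrand of the orbit norm\<close>

text \<open>
  At a point \<open>x\<close>, the value \<open>orbit_fun f x\<close> is the norm in the weighted space \<open>l\<^sub>2\<close> of the sequence of values of
  \<open>f\<close> along the orbit of \<open>x\<close>, provided that this sequence is square summable.
\<close>

locale orbit_weights = invertible_system M T for M :: "'w measure" and T +
  fixes a :: "int \<Rightarrow> real"
  assumes a_pos: "a k > 0" and sqrt_a: "(\<lambda>k. sqrt (a k)) summable_on UNIV"
begin

definition orbit_fun :: "('w \<Rightarrow> 'b::real_normed_vector) \<Rightarrow> 'w \<Rightarrow> real" where
  "orbit_fun f x = sqrt (\<Sum>\<^sub>\<infinity>k. a k * (norm (f (iterate k x)))\<^sup>2)"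

definition square_summable :: "('w \<Rightarrow> 'b::real_normed_vector) \<Rightarrow> 'w \<Rightarrow> bool" where
  "square_summable f x \<longleftrightarrow> (\<lambda>k. a k * (norm (f (iterate k x)))\<^sup>2) summable_on UNIV"

lemma orbit_norm_eq: "orbit_norm M T a f = (\<integral>x. orbit_fun f x \<partial>M)"
  by (simp add: orbit_norm_def orbit_fun_def)

lemma orbit_fun_nonneg: "orbit_fun f x \<ge> 0"
  using a_pos by (auto simp: orbit_fun_def less_imp_le intro!: infsum_nonneg)

lemma orbit_fun_square: "(orbit_fun f x)\<^sup>2 = (\<Sum>\<^sub>\<infinity>k. a k * (norm (f (iterate k x)))\<^sup>2)"
  unfolding orbit_fun_def using a_pos
  by (intro real_sqrt_pow2 infsum_nonneg) (simp add: less_imp_le)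

lemma orbit_fun_measurable:
  fixes f :: "'w \<Rightarrow> 'b::{real_normed_vector, second_countable_topology}"
  assumes [measurable]: "f \<in> borel_measurable M"
  shows "orbit_fun f \<in> borel_measurable M"
proof -
  have [measurable]: "(\<lambda>x. \<Sum>\<^sub>\<infinity>k. a k * (norm (f (iterate k x)))\<^sup>2) \<in> borel_measurable M"
    using a_pos by (intro borel_measurable_infsum_int) (auto simp: less_imp_le)
  show ?thesis unfolding orbit_fun_def[abs_def] by measurable
qed

text \<open>
  The norm of an \<open>l\<^sub>2\<close> sequence is at most its \<open>l\<^sub>1\<close> norm, here \<open>\<Sum>k. sqrt (a k) * norm (f (iterate k x))\<close>.
  By Tonelli and invariance of the measure the integral of the latter is a multiple of the norm of
  \<open>f\<close> in \<open>L\<^sub>1\<close>; in particular it is finite almost everywhere.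
\<close>

lemma orbit_fun_dominated:
  fixes f :: "'w \<Rightarrow> 'b::{banach, second_countable_topology}"
  assumes f: "integrable M f"
  shows "AE x in M. square_summable f x"
    and "integrable M (orbit_fun f)"
    and "(\<integral>x. orbit_fun f x \<partial>M) \<le> (\<Sum>\<^sub>\<infinity>k. sqrt (a k)) * (\<integral>x. norm (f x) \<partial>M)"
proof -
  have [measurable]: "f \<in> borel_measurable M" using f by auto
  define g where "g k x = sqrt (a k) * norm (f (iterate k x))" for k x
  define m where "m = (\<integral>x. norm (f x) \<partial>M)"
  define K where "K = (\<Sum>\<^sub>\<infinity>k. sqrt (a k))"
  have m0: "m \<ge> 0" by (simp add: m_def)
  have K0: "K \<ge> 0" unfolding K_def using a_pos by (intro infsum_nonneg) (simp add: less_imp_le)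
  have g0: "g k x \<ge> 0" for k x using a_pos[of k] by (simp add: g_def)
  have [measurable]: "g k \<in> borel_measurable M" for k unfolding g_def by measurable
  note sum_g = summable_on_count_space[of "\<lambda>k. g k x" for x, OF g0]
  define G where "G x = (\<integral>\<^sup>+k. ennreal (g k x) \<partial>count_space UNIV)" for x
  have G_meas[measurable]: "G \<in> borel_measurable M"
    unfolding G_def nn_integral_count_space_int by measurable
  have "(\<integral>\<^sup>+x. G x \<partial>M) = (\<integral>\<^sup>+k. \<integral>\<^sup>+x. ennreal (g k x) \<partial>M \<partial>count_space UNIV)"
    unfolding G_def by (rule nn_integral_count_space_nn_integral) auto
  also have "\<dots> = (\<integral>\<^sup>+k. ennreal (sqrt (a k)) * ennreal m \<partial>count_space UNIV)"
  proof (rule nn_integral_cong)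
    fix k
    have "(\<integral>\<^sup>+x. ennreal (g k x) \<partial>M) = ennreal (sqrt (a k)) * (\<integral>\<^sup>+x. ennreal (norm (f (iterate k x))) \<partial>M)"
      using a_pos[of k] by (simp add: g_def ennreal_mult nn_integral_cmult)
    also have "(\<integral>\<^sup>+x. ennreal (norm (f (iterate k x))) \<partial>M) = (\<integral>\<^sup>+x. ennreal (norm (f x)) \<partial>M)"
      by (rule nn_integral_iterate) simp
    also have "\<dots> = ennreal m"
      unfolding m_def using f by (intro nn_integral_eq_integral) auto
    finally show "(\<integral>\<^sup>+x. ennreal (g k x) \<partial>M) = ennreal (sqrt (a k)) * ennreal m" .
  qed
  also have "\<dots> = (\<integral>\<^sup>+k. ennreal (sqrt (a k)) \<partial>count_space UNIV) * ennreal m"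
    by (rule nn_integral_multc) simp
  also have "(\<integral>\<^sup>+k. ennreal (sqrt (a k)) \<partial>count_space UNIV) = ennreal K"
    using summable_on_count_space[of "\<lambda>k. sqrt (a k)"] sqrt_a a_pos
    by (simp add: K_def less_imp_le less_top)
  finally have IG: "(\<integral>\<^sup>+x. G x \<partial>M) = ennreal (K * m)"
    using K0 by (simp add: ennreal_mult')
  then have "AE x in M. G x \<noteq> \<infinity>"
    by (intro nn_integral_noteq_infinite) auto
  then have AEg: "AE x in M. (\<lambda>k. g k x) summable_on UNIV"
    by eventually_elim (use sum_g(1) in \<open>simp add: G_def less_top\<close>)
  have sq: "a k * (norm (f (iterate k x)))\<^sup>2 = (g k x)\<^sup>2" for k x
    using a_pos[of k] by (simp add: g_def power_mult_distrib)
  show "AE x in M. square_summable f x"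
    using AEg by eventually_elim (auto simp: square_summable_def sq intro: infsum_square_le g0)
  have le: "AE x in M. ennreal (orbit_fun f x) \<le> G x"
    using AEg
  proof eventually_elim
    case (elim x)
    have S0: "(\<Sum>\<^sub>\<infinity>k. g k x) \<ge> 0" by (intro infsum_nonneg g0)
    have "orbit_fun f x \<le> sqrt ((\<Sum>\<^sub>\<infinity>k. g k x)\<^sup>2)"
      unfolding orbit_fun_def sq using infsum_square_le(2)[OF g0 elim] by (rule real_sqrt_le_mono)
    also have "\<dots> = (\<Sum>\<^sub>\<infinity>k. g k x)" using S0 by simp
    also have "\<dots> = enn2real (G x)" unfolding G_def by (rule sum_g(2))
    finally have "ennreal (orbit_fun f x) \<le> ennreal (enn2real (G x))" by (rule ennreal_leI)
    also have "\<dots> = G x"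
      using elim sum_g(1) by (simp add: G_def less_top)
    finally show ?case .
  qed
  have [measurable]: "orbit_fun f \<in> borel_measurable M" by (rule orbit_fun_measurable) simp
  have I: "(\<integral>\<^sup>+x. ennreal (orbit_fun f x) \<partial>M) \<le> ennreal (K * m)"
    using nn_integral_mono_AE[OF le] IG by simp
  show int: "integrable M (orbit_fun f)"
    using le_less_trans[OF I ennreal_less_top]
    by (intro integrableI_bounded) (auto simp: abs_of_nonneg[OF orbit_fun_nonneg])
  show "(\<integral>x. orbit_fun f x \<partial>M) \<le> (\<Sum>\<^sub>\<infinity>k. sqrt (a k)) * (\<integral>x. norm (f x) \<partial>M)"
  proof -
    have "ennreal (\<integral>x. orbit_fun f x \<partial>M) \<le> ennreal (K * m)"
      using I nn_integral_eq_integral[OF int] by (simp add: orbit_fun_nonneg)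
    then show ?thesis using K0 m0 by (simp add: ennreal_le_iff K_def m_def)
  qed
qed

end

section \<open>Perturbations that almost preserve the norm\<close>

text \<open>
  The numbers stand for \<open>n = \<parallel>x\<parallel>\<close>, \<open>s = \<parallel>x + y\<parallel>\<close>, \<open>r = \<parallel>x - y\<parallel>\<close>, \<open>p = x \<bullet> y\<close> and \<open>q = \<parallel>y\<parallel>\<^sup>2\<close> in a Hilbert
  space, so the last bound concerns \<open>\<parallel>y - t x\<parallel>\<^sup>2\<close>. If the defect \<open>\<delta>\<close> in the triangle inequality is
  small, then \<open>y\<close> is close to \<open>t x\<close>. The coefficient \<open>t\<close> is not that of the orthogonal
  projection. It is chosen so that \<open>t * n = (s - r) / 2\<close>, which later makes its weighted mean
  computable from norms alone, and it satisfies the identity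
  \<open>\<parallel>y - t x\<parallel>\<^sup>2 = n * \<delta> * (1 - t\<^sup>2) + \<delta>\<^sup>2 / 4\<close>.
\<close>

lemma midpoint_estimate:
  fixes n s r p q :: real
  assumes n: "n > 0" and s: "s \<ge> 0" "s\<^sup>2 = n\<^sup>2 + 2 * p + q" and r: "r \<ge> 0" "r\<^sup>2 = n\<^sup>2 - 2 * p + q"
    and CS: "p\<^sup>2 \<le> q * n\<^sup>2"
  defines "\<delta> \<equiv> s + r - 2 * n" and "t \<equiv> (s - r) / (2 * n)"
  shows "\<bar>t\<bar> \<le> 1" "\<delta> \<ge> 0" "q - 2 * t * p + t\<^sup>2 * n\<^sup>2 \<le> n * \<delta> + \<delta>\<^sup>2 / 4"
proof -
  \<comment> \<open>Both triangle inequalities follow from \<open>\<bar>n\<^sup>2 - q\<bar> \<le> s * r\<close>, a form of the Cauchy-Schwarz inequality.\<close>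
  have "(n\<^sup>2 - q)\<^sup>2 \<le> (n\<^sup>2 - q)\<^sup>2 + 4 * (q * n\<^sup>2 - p\<^sup>2)"
    using CS by simp
  also have "\<dots> = (n\<^sup>2 + 2 * p + q) * (n\<^sup>2 - 2 * p + q)"
    by (simp add: power2_eq_square algebra_simps)
  also have "\<dots> = (s * r)\<^sup>2"
    by (simp only: power_mult_distrib s(2) r(2))
  finally have "\<bar>n\<^sup>2 - q\<bar> \<le> \<bar>s * r\<bar>"
    by (simp only: abs_le_square_iff)
  moreover have "\<bar>s * r\<bar> = s * r" using s(1) r(1) by simp
  ultimately have sr: "n\<^sup>2 - q \<le> s * r" "q - n\<^sup>2 \<le> s * r" by linarith+
  have "(s + r)\<^sup>2 = 2 * n\<^sup>2 + 2 * q + 2 * (s * r)" "(s - r)\<^sup>2 = 2 * n\<^sup>2 + 2 * q - 2 * (s * r)"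
    by (simp_all only: power2_sum power2_diff s(2) r(2))
  moreover have "(2 * n)\<^sup>2 = 4 * n\<^sup>2" by simp
  ultimately have squares: "(2 * n)\<^sup>2 \<le> (s + r)\<^sup>2" "(s - r)\<^sup>2 \<le> (2 * n)\<^sup>2"
    using sr by linarith+
  have "2 * n \<le> s + r" by (rule power2_le_imp_le[OF squares(1)]) (use s(1) r(1) in simp)
  then show \<delta>: "\<delta> \<ge> 0" by (simp add: \<delta>_def)
  have "\<bar>s - r\<bar> \<le> \<bar>2 * n\<bar>" using squares(2) by (simp only: abs_le_square_iff)
  then show t: "\<bar>t\<bar> \<le> 1" using n by (simp add: t_def)
  have "s - r = 2 * (t * n)" "s + r = 2 * n + \<delta>" using n by (simp_all add: t_def \<delta>_def)
  then have s_eq: "s = n + \<delta> / 2 + t * n" and r_eq: "r = n + \<delta> / 2 - t * n" by linarith+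
  have "4 * p = s\<^sup>2 - r\<^sup>2" using s(2) r(2) by linarith
  also have "\<dots> = 4 * ((n + \<delta> / 2) * (t * n))"
    unfolding s_eq r_eq power2_sum power2_diff by simp
  finally have p: "2 * p = 2 * ((n + \<delta> / 2) * (t * n))" by linarith
  have "2 * (q + n\<^sup>2) = s\<^sup>2 + r\<^sup>2" unfolding s(2) r(2) by simp
  also have "\<dots> = 2 * ((n + \<delta> / 2)\<^sup>2 + (t * n)\<^sup>2)"
    unfolding s_eq r_eq power2_sum power2_diff by simp
  also have "(n + \<delta> / 2)\<^sup>2 = n\<^sup>2 + n * \<delta> + \<delta>\<^sup>2 / 4"
    by (simp add: power2_sum power_divide)
  finally have q: "q = n * \<delta> + \<delta>\<^sup>2 / 4 + t\<^sup>2 * n\<^sup>2"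
    unfolding power_mult_distrib by simp
  have "q - 2 * t * p + t\<^sup>2 * n\<^sup>2 = q - t * (2 * p) + t\<^sup>2 * n\<^sup>2" by simp
  also have "\<dots> = n * \<delta> + \<delta>\<^sup>2 / 4 - t\<^sup>2 * (n * \<delta>)"
    unfolding p q by (simp add: power2_eq_square algebra_simps)
  finally have "q - 2 * t * p + t\<^sup>2 * n\<^sup>2 = n * \<delta> + \<delta>\<^sup>2 / 4 - t\<^sup>2 * (n * \<delta>)" .
  moreover have "t\<^sup>2 * (n * \<delta>) \<ge> 0" using n \<delta> by simp
  ultimately show "q - 2 * t * p + t\<^sup>2 * n\<^sup>2 \<le> n * \<delta> + \<delta>\<^sup>2 / 4" by linarith
qed

context orbit_weights
begin

text \<open>
  The Hilbert space estimate, applied at one point to the sequences of values along the orbit. The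
  square norm of \<open>h - c f\<close> is a linear combination of those of \<open>f\<close>, \<open>f + h\<close> and \<open>f - h\<close>, and it is
  nonnegative for \<open>c = p / n\<^sup>2\<close>, which is the Cauchy-Schwarz inequality. The norm of each entry
  is bounded by that of the whole sequence.
\<close>

lemma orbit_midpoint_estimate:
  fixes f h :: "'w \<Rightarrow> 'b::real_inner"
  assumes "square_summable f x" "square_summable (\<lambda>x. f x + h x) x" "square_summable (\<lambda>x. f x - h x) x"
    and n0: "orbit_fun f x > 0"
  defines "n \<equiv> orbit_fun f x" and "s \<equiv> orbit_fun (\<lambda>x. f x + h x) x" and "r \<equiv> orbit_fun (\<lambda>x. f x - h x) x"
  defines "\<delta> \<equiv> s + r - 2 * n" and "t \<equiv> (s - r) / (2 * n)"
  shows "\<bar>t\<bar> \<le> 1" "\<delta> \<ge> 0"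
    "sqrt (a k) * norm (h (iterate k x) - t *\<^sub>R f (iterate k x)) \<le> sqrt (n * \<delta> + \<delta>\<^sup>2 / 4)"
proof -
  define p where "p = (s\<^sup>2 - r\<^sup>2) / 4"
  define q where "q = (s\<^sup>2 + r\<^sup>2) / 2 - n\<^sup>2"
  let ?f = "\<lambda>k. f (iterate k x)" and ?h = "\<lambda>k. h (iterate k x)"
  have n: "((\<lambda>k. a k * (norm (?f k))\<^sup>2) has_sum n\<^sup>2) UNIV"
    and s: "((\<lambda>k. a k * (norm (?f k + ?h k))\<^sup>2) has_sum s\<^sup>2) UNIV"
    and r: "((\<lambda>k. a k * (norm (?f k - ?h k))\<^sup>2) has_sum r\<^sup>2) UNIV"
    using assms(1-3) unfolding n_def s_def r_def orbit_fun_square square_summable_def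
    by (auto intro: has_sum_infsum)
  have sum: "((\<lambda>k. a k * (norm (?h k - c *\<^sub>R ?f k))\<^sup>2) has_sum (q - 2 * c * p + c\<^sup>2 * n\<^sup>2)) UNIV" for c
  proof -
    have eq: "a k * (norm (?h k - c *\<^sub>R ?f k))\<^sup>2 = (1 / 2 - c / 2) * (a k * (norm (?f k + ?h k))\<^sup>2)
        + (1 / 2 + c / 2) * (a k * (norm (?f k - ?h k))\<^sup>2) + (c\<^sup>2 - 1) * (a k * (norm (?f k))\<^sup>2)" for k
      unfolding power2_norm_eq_inner
      by (simp add: inner_add_left inner_add_right inner_diff_left inner_diff_right
          inner_commute[of "?h k" "?f k"] power2_eq_square field_simps)
    have "((\<lambda>k. a k * (norm (?h k - c *\<^sub>R ?f k))\<^sup>2) has_sum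
      ((1 / 2 - c / 2) * s\<^sup>2 + (1 / 2 + c / 2) * r\<^sup>2 + (c\<^sup>2 - 1) * n\<^sup>2)) UNIV"
      unfolding eq by (intro has_sum_add has_sum_cmult_right s r n)
    also have "(1 / 2 - c / 2) * s\<^sup>2 + (1 / 2 + c / 2) * r\<^sup>2 + (c\<^sup>2 - 1) * n\<^sup>2 = q - 2 * c * p + c\<^sup>2 * n\<^sup>2"
      by (simp add: p_def q_def field_simps)
    finally show ?thesis .
  qed
  have n_pos: "n > 0" using n0 by (simp add: n_def)
  have term_nonneg: "a k * (norm (?h k - c *\<^sub>R ?f k))\<^sup>2 \<ge> 0" for k c
    using a_pos[of k] by simp
  have "0 \<le> q - 2 * (p / n\<^sup>2) * p + (p / n\<^sup>2)\<^sup>2 * n\<^sup>2"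
    by (rule has_sum_nonneg[OF sum term_nonneg])
  also have "\<dots> = q - p\<^sup>2 / n\<^sup>2" using n_pos by (simp add: power2_eq_square field_simps)
  finally have CS: "p\<^sup>2 \<le> q * n\<^sup>2" using n_pos by (simp add: field_simps)
  have s2: "s \<ge> 0" "s\<^sup>2 = n\<^sup>2 + 2 * p + q" by (simp_all add: s_def orbit_fun_nonneg p_def q_def field_simps)
  have r2: "r \<ge> 0" "r\<^sup>2 = n\<^sup>2 - 2 * p + q" by (simp_all add: r_def orbit_fun_nonneg p_def q_def field_simps)
  note est = midpoint_estimate[OF n_pos s2 r2 CS, folded \<delta>_def t_def]
  show "\<bar>t\<bar> \<le> 1" "\<delta> \<ge> 0" by (fact est)+
  have "a k * (norm (?h k - t *\<^sub>R ?f k))\<^sup>2 \<le> q - 2 * t * p + t\<^sup>2 * n\<^sup>2"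
    using finite_sum_le_has_sum[OF sum[of t], of "{k}"] term_nonneg by simp
  also have "\<dots> \<le> n * \<delta> + \<delta>\<^sup>2 / 4" by (fact est)
  finally have "sqrt (a k * (norm (?h k - t *\<^sub>R ?f k))\<^sup>2) \<le> sqrt (n * \<delta> + \<delta>\<^sup>2 / 4)"
    by (rule real_sqrt_le_mono)
  then show "sqrt (a k) * norm (?h k - t *\<^sub>R ?f k) \<le> sqrt (n * \<delta> + \<delta>\<^sup>2 / 4)"
    by (simp add: real_sqrt_mult)
qed

end

section \<open>The orbit norm of an ergodic system is wMLUR\<close>

locale ergodic_orbit_weights = ergodic_system M T + orbit_weights M T a
  for M :: "'w measure" and T and a
begin

text \<open>
  The integrals of the defects \<open>\<delta> n\<close> tend to zero, so almost every orbit sequence of \<open>h n\<close> is close to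
  the multiple by \<open>t n x\<close> of that of \<open>f\<close>. The points \<open>x\<close> and \<open>T x\<close> have the same orbit, and by
  ergodicity \<open>f\<close> does not vanish along it; so \<open>t n x\<close> and \<open>t n (T x)\<close> are close. Hence \<open>t n\<close> behaves
  weakly like its mean. The mean tends to zero because the integral of \<open>t n * orbit_fun f\<close> is half
  the difference of the norms of \<open>f + h n\<close> and \<open>f - h n\<close>, while \<open>orbit_fun f\<close> has integral \<open>1\<close>.
\<close>

lemma midpoint_perturbations_are_multiples:
  fixes f :: "'w \<Rightarrow> 'b::{real_normed_field, euclidean_space}" and h :: "nat \<Rightarrow> 'w \<Rightarrow> 'b"
  assumes f: "integrable M f" and h: "\<And>n. integrable M (h n)"
    and norm1: "orbit_norm M T a f = 1"
    and plus: "(\<lambda>n. orbit_norm M T a (\<lambda>x. f x + h n x)) \<longlonglongrightarrow> 1"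
    and minus: "(\<lambda>n. orbit_norm M T a (\<lambda>x. f x - h n x)) \<longlonglongrightarrow> 1"
  shows "\<exists>t :: nat \<Rightarrow> 'w \<Rightarrow> real.
    (\<forall>n. t n \<in> borel_measurable M) \<and> (\<forall>n x. \<bar>t n x\<bar> \<le> 1) \<and>
    (\<lambda>n. \<integral>x. norm (h n x - t n x *\<^sub>R f x) \<partial>M) \<longlonglongrightarrow> 0 \<and>
    (\<forall>g. integrable M g \<longrightarrow> (\<lambda>n. \<integral>x. t n x * g x \<partial>M) \<longlonglongrightarrow> 0)"
proof -
  define F where "F = orbit_fun f"
  define s where "s n = orbit_fun (\<lambda>x. f x + h n x)" for n
  define r where "r n = orbit_fun (\<lambda>x. f x - h n x)" for n
  define \<delta> where "\<delta> n x = s n x + r n x - 2 * F x" for n x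
  \<comment> \<open>The clamping to \<open>[- 1, 1]\<close> acts on a null set only; it makes \<open>t n\<close> bounded everywhere.\<close>
  define t where "t n x = max (- 1) (min 1 ((s n x - r n x) / (2 * F x)))" for n x
  define e where "e n x = sqrt (F x * \<delta> n x + (\<delta> n x)\<^sup>2 / 4)" for n x
  have [measurable]: "f \<in> borel_measurable M" "h n \<in> borel_measurable M" for n
    using f h by auto
  have [measurable]: "F \<in> borel_measurable M" "s n \<in> borel_measurable M" "r n \<in> borel_measurable M" for n
    unfolding F_def s_def r_def by (auto intro!: orbit_fun_measurable)
  have [measurable]: "\<delta> n \<in> borel_measurable M" for n unfolding \<delta>_def by measurable
  have t_meas[measurable]: "t n \<in> borel_measurable M" for n unfolding t_def by measurable
  have e_meas[measurable]: "e n \<in> borel_measurable M" for n unfolding e_def by measurable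
  have t1: "\<bar>t n x\<bar> \<le> 1" for n x by (auto simp: t_def)
  have F0: "F x \<ge> 0" for x by (simp add: F_def orbit_fun_nonneg)
  have Fi: "integrable M F" and si: "integrable M (s n)" and ri: "integrable M (r n)" for n
    unfolding F_def s_def r_def using f h by (auto intro!: orbit_fun_dominated(2))
  have F1: "(\<integral>x. F x \<partial>M) = 1" using norm1 by (simp add: orbit_norm_eq F_def)
  have s_lim: "(\<lambda>n. \<integral>x. s n x \<partial>M) \<longlonglongrightarrow> 1" using plus by (simp add: orbit_norm_eq s_def)
  have r_lim: "(\<lambda>n. \<integral>x. r n x \<partial>M) \<longlonglongrightarrow> 1" using minus by (simp add: orbit_norm_eq r_def)
  have \<delta>i: "integrable M (\<delta> n)" for n unfolding \<delta>_def using Fi si ri by simp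

  have "\<not> (AE x in M. f x = 0)"
  proof
    assume "AE x in M. f x = 0"
    then have "(\<integral>x. norm (f x) \<partial>M) = 0" by (intro integral_eq_zero_AE) auto
    with orbit_fun_dominated(3)[OF f] F1 show False by (simp add: F_def)
  qed
  from AE_orbit_meets_support[OF _ this]
  have AE_supp: "AE x in M. \<exists>k. f (iterate k x) \<noteq> 0" by simp
  have AE_sq: "AE x in M. square_summable f x \<and>
      (\<forall>n. square_summable (\<lambda>x. f x + h n x) x \<and> square_summable (\<lambda>x. f x - h n x) x)"
    unfolding AE_conj_iff AE_all_countable
    by (intro conjI allI orbit_fun_dominated(1) Bochner_Integration.integrable_add
        Bochner_Integration.integrable_diff f h)
  have AE_pos: "AE x in M. F x > 0"
    using AE_supp AE_sq
  proof eventually_elim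
    case (elim x)
    then obtain k where k: "f (iterate k x) \<noteq> 0" by blast
    have "0 < a k * (norm (f (iterate k x)))\<^sup>2" using a_pos[of k] k by simp
    also have "\<dots> \<le> (F x)\<^sup>2"
      unfolding F_def orbit_fun_square
      using finite_sum_le_infsum[of "\<lambda>k. a k * (norm (f (iterate k x)))\<^sup>2" UNIV "{k}"] elim(2)
      by (simp add: square_summable_def a_pos less_imp_le)
    finally show ?case using F0[of x] by (cases "F x = 0") auto
  qed
  have AE_est: "AE x in M. \<forall>n. t n x * F x = (s n x - r n x) / 2 \<and> \<delta> n x \<ge> 0 \<and>
      (\<forall>k. sqrt (a k) * norm (h n (iterate k x) - t n x *\<^sub>R f (iterate k x)) \<le> e n x)"
    using AE_sq AE_pos
  proof eventually_elim
    case (elim x)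
    show ?case
    proof
      fix n
      have "orbit_fun f x > 0" using elim(2) by (simp add: F_def)
      note est = orbit_midpoint_estimate[of f x "h n", OF _ _ _ this,
          folded F_def s_def r_def, folded \<delta>_def, folded e_def]
      have *: "\<bar>(s n x - r n x) / (2 * F x)\<bar> \<le> 1" using elim est(1) by simp
      then have "t n x = (s n x - r n x) / (2 * F x)" unfolding t_def by linarith
      with elim est(2,3) show "t n x * F x = (s n x - r n x) / 2 \<and> \<delta> n x \<ge> 0 \<and>
          (\<forall>k. sqrt (a k) * norm (h n (iterate k x) - t n x *\<^sub>R f (iterate k x)) \<le> e n x)"
        by simp
    qed
  qed

  have \<delta>_lim: "(\<lambda>n. \<integral>x. \<delta> n x \<partial>M) \<longlonglongrightarrow> 0"
  proof -
    have "(\<lambda>n. (\<integral>x. s n x \<partial>M) + (\<integral>x. r n x \<partial>M) - 2) \<longlonglongrightarrow> 1 + 1 - 2"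
      by (intro tendsto_intros s_lim r_lim)
    moreover have "(\<integral>x. \<delta> n x \<partial>M) = (\<integral>x. s n x \<partial>M) + (\<integral>x. r n x \<partial>M) - 2" for n
      using si ri Fi F1 by (simp add: \<delta>_def)
    ultimately show ?thesis by simp
  qed
  have e0: "AE x in M. e n x \<ge> 0" for n
    using AE_est by eventually_elim (simp add: e_def F0)
  \<comment> \<open>The weighted arithmetic-geometric mean inequality, with the weight \<open>\<eta>\<close> free to be chosen small.\<close>
  have e_le: "AE x in M. e n x \<le> \<eta> * F x / 2 + (1 / (2 * \<eta>) + 1 / 2) * \<delta> n x" if \<eta>: "\<eta> > 0" for \<eta> n
    using AE_est
  proof eventually_elim
    case (elim x)
    then have d: "\<delta> n x \<ge> 0" by blast
    have "F x * \<delta> n x = (\<eta> * F x) * (\<delta> n x / \<eta>)" using \<eta> by simp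
    then have "sqrt (F x * \<delta> n x) \<le> (\<eta> * F x + \<delta> n x / \<eta>) / 2"
      using \<eta> d F0[of x] arith_geo_mean_sqrt[of "\<eta> * F x" "\<delta> n x / \<eta>"] by simp
    moreover have "e n x \<le> sqrt (F x * \<delta> n x) + sqrt ((\<delta> n x)\<^sup>2 / 4)"
      unfolding e_def using d F0[of x] by (intro sqrt_add_le_add_sqrt) auto
    moreover have "sqrt ((\<delta> n x)\<^sup>2 / 4) = \<delta> n x / 2" using d by (simp add: real_sqrt_divide)
    ultimately show ?case by (simp add: field_simps)
  qed
  have ei: "integrable M (e n)" for n
  proof (rule Bochner_Integration.integrable_bound)
    show "integrable M (\<lambda>x. 1 * F x / 2 + (1 / (2 * 1) + 1 / 2) * \<delta> n x)"
      using Fi \<delta>i by simp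
    show "AE x in M. norm (e n x) \<le> norm (1 * F x / 2 + (1 / (2 * 1) + 1 / 2) * \<delta> n x)"
      using e0[of n] e_le[OF zero_less_one, of n] by eventually_elim simp
  qed simp
  have e_lim: "(\<lambda>n. \<integral>x. e n x \<partial>M) \<longlonglongrightarrow> 0"
  proof (rule LIMSEQ_I)
    fix \<eta> :: real assume \<eta>: "\<eta> > 0"
    define C where "C = 1 / (2 * \<eta>) + 1 / 2"
    have C: "C > 0" using \<eta> by (simp add: C_def add_pos_pos)
    have "eventually (\<lambda>n. (\<integral>x. \<delta> n x \<partial>M) < \<eta> / (2 * C)) sequentially"
      using \<eta> C by (intro order_tendstoD(2)[OF \<delta>_lim]) simp
    then obtain n0 where n0: "\<And>n. n \<ge> n0 \<Longrightarrow> (\<integral>x. \<delta> n x \<partial>M) < \<eta> / (2 * C)"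
      by (auto simp: eventually_sequentially)
    show "\<exists>n0. \<forall>n\<ge>n0. norm ((\<integral>x. e n x \<partial>M) - 0) < \<eta>"
    proof (intro exI allI impI)
      fix n assume n: "n \<ge> n0"
      have "(\<integral>x. e n x \<partial>M) \<le> (\<integral>x. \<eta> * F x / 2 + C * \<delta> n x \<partial>M)"
        unfolding C_def by (rule integral_mono_AE[OF ei _ e_le[OF \<eta>]]) (use Fi \<delta>i in simp)
      also have "\<dots> = \<eta> / 2 + C * (\<integral>x. \<delta> n x \<partial>M)"
        using Fi \<delta>i F1 by simp
      also have "\<dots> < \<eta>" using n0[OF n] C by (simp add: field_simps)
      finally show "norm ((\<integral>x. e n x \<partial>M) - 0) < \<eta>"
        using integral_nonneg_AE[OF e0] by simp
    qed
  qed

  have close: "(\<lambda>n. \<integral>x. norm (h n x - t n x *\<^sub>R f x) \<partial>M) \<longlonglongrightarrow> 0"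
  proof (rule tendsto_sandwich[OF _ _ tendsto_const])
    show "(\<lambda>n. (\<integral>x. e n x \<partial>M) / sqrt (a 0)) \<longlonglongrightarrow> 0"
      using tendsto_divide[OF e_lim tendsto_const[of "sqrt (a 0)"]] a_pos[of 0] by simp
    show "eventually (\<lambda>n. (\<integral>x. norm (h n x - t n x *\<^sub>R f x) \<partial>M) \<le> (\<integral>x. e n x \<partial>M) / sqrt (a 0)) sequentially"
    proof (rule always_eventually, rule allI)
      fix n
      have "integrable M (\<lambda>x. t n x *\<^sub>R f x)"
        by (rule bounded_measurable_integrable_scaleR[OF bounded_measurableI[OF t_meas t1] f])
      moreover have "AE x in M. norm (h n x - t n x *\<^sub>R f x) \<le> e n x / sqrt (a 0)"
        using AE_est
      proof eventually_elim
        case (elim x)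
        then have "sqrt (a 0) * norm (h n (iterate 0 x) - t n x *\<^sub>R f (iterate 0 x)) \<le> e n x" by blast
        then show ?case using a_pos[of 0] by (simp add: iterate_0 field_simps)
      qed
      ultimately have "(\<integral>x. norm (h n x - t n x *\<^sub>R f x) \<partial>M) \<le> (\<integral>x. e n x / sqrt (a 0) \<partial>M)"
        using h ei by (intro integral_mono_AE) auto
      then show "(\<integral>x. norm (h n x - t n x *\<^sub>R f x) \<partial>M) \<le> (\<integral>x. e n x \<partial>M) / sqrt (a 0)" by simp
    qed
  qed simp

  have invariant: "(\<lambda>n. \<integral>x. \<bar>t n (T x) - t n x\<bar> \<partial>M) \<longlonglongrightarrow> 0"
  proof (rule L1_tendsto_zero_of_pointwise_bound[where B=2 and E="\<lambda>n x. \<bar>e n x\<bar> + \<bar>e n (T x)\<bar>"])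
    show "\<bar>t n (T x) - t n x\<bar> \<le> 2" for n x using t1[of n x] t1[of n "T x"] by linarith
    show "integrable M (\<lambda>x. \<bar>e n x\<bar> + \<bar>e n (T x)\<bar>)" for n
      using ei integrable_T[OF ei] by simp
    have "(\<integral>x. \<bar>\<bar>e n x\<bar> + \<bar>e n (T x)\<bar>\<bar> \<partial>M) = 2 * (\<integral>x. e n x \<partial>M)" for n
    proof -
      have "(\<integral>x. \<bar>\<bar>e n x\<bar> + \<bar>e n (T x)\<bar>\<bar> \<partial>M) = (\<integral>x. \<bar>e n x\<bar> \<partial>M) + (\<integral>x. \<bar>e n (T x)\<bar> \<partial>M)"
        using ei integrable_T[OF ei] by simp
      also have "(\<integral>x. \<bar>e n (T x)\<bar> \<partial>M) = (\<integral>x. \<bar>e n x\<bar> \<partial>M)"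
        by (rule integral_T[of "\<lambda>x. \<bar>e n x\<bar>"]) simp
      also have "(\<integral>x. \<bar>e n x\<bar> \<partial>M) = (\<integral>x. e n x \<partial>M)"
      proof (rule integral_cong_AE)
        show "AE x in M. \<bar>e n x\<bar> = e n x" using e0[of n] by eventually_elim simp
      qed measurable
      finally show ?thesis by simp
    qed
    then show "(\<lambda>n. \<integral>x. \<bar>\<bar>e n x\<bar> + \<bar>e n (T x)\<bar>\<bar> \<partial>M) \<longlonglongrightarrow> 0"
      using tendsto_mult_right_zero[OF e_lim, of 2] by simp
    show "AE x in M. \<exists>C. \<forall>n. \<bar>t n (T x) - t n x\<bar> \<le> C * \<bar>\<bar>e n x\<bar> + \<bar>e n (T x)\<bar>\<bar>"
      using AE_supp AE_est AE_T[OF AE_est] AE_space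
    proof eventually_elim
      case (elim x)
      obtain k where k: "f (iterate k x) \<noteq> 0" using elim(1) by blast
      \<comment> \<open>The position \<open>k\<close> on the orbit of \<open>x\<close> is the position \<open>k - 1\<close> on the orbit of \<open>T x\<close>.\<close>
      define \<alpha> where "\<alpha> = min (sqrt (a k)) (sqrt (a (k - 1)))"
      have \<alpha>: "\<alpha> > 0" "\<alpha> \<le> sqrt (a k)" "\<alpha> \<le> sqrt (a (k - 1))"
        using a_pos by (auto simp: \<alpha>_def)
      have "\<bar>t n (T x) - t n x\<bar> \<le> 1 / (\<alpha> * norm (f (iterate k x))) * \<bar>\<bar>e n x\<bar> + \<bar>e n (T x)\<bar>\<bar>" for n
      proof -
        let ?f = "f (iterate k x)" and ?h = "h n (iterate k x)"
        have "sqrt (a k) * norm (?h - t n x *\<^sub>R ?f) \<le> e n x"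
          using elim(2) by blast
        then have 1: "\<alpha> * norm (?h - t n x *\<^sub>R ?f) \<le> \<bar>e n x\<bar>"
          using mult_right_mono[OF \<alpha>(2) norm_ge_zero[of "?h - t n x *\<^sub>R ?f"]] by linarith
        have "sqrt (a (k - 1)) * norm (h n (iterate (k - 1) (T x)) - t n (T x) *\<^sub>R f (iterate (k - 1) (T x))) \<le> e n (T x)"
          using elim(3) by blast
        then have "sqrt (a (k - 1)) * norm (?h - t n (T x) *\<^sub>R ?f) \<le> e n (T x)"
          using elim(4) by (simp add: iterate_T)
        then have 2: "\<alpha> * norm (?h - t n (T x) *\<^sub>R ?f) \<le> \<bar>e n (T x)\<bar>"
          using mult_right_mono[OF \<alpha>(3) norm_ge_zero[of "?h - t n (T x) *\<^sub>R ?f"]] by linarith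
        have "\<bar>t n (T x) - t n x\<bar> * norm ?f = norm ((?h - t n x *\<^sub>R ?f) - (?h - t n (T x) *\<^sub>R ?f))"
          by (simp add: scaleR_left_diff_distrib[symmetric])
        also have "\<dots> \<le> norm (?h - t n x *\<^sub>R ?f) + norm (?h - t n (T x) *\<^sub>R ?f)"
          by (rule norm_triangle_ineq4)
        finally have "\<alpha> * (\<bar>t n (T x) - t n x\<bar> * norm ?f)
            \<le> \<alpha> * (norm (?h - t n x *\<^sub>R ?f) + norm (?h - t n (T x) *\<^sub>R ?f))"
          using \<alpha>(1) by (intro mult_left_mono) auto
        also have "\<dots> \<le> \<bar>e n x\<bar> + \<bar>e n (T x)\<bar>" using 1 2 by (simp add: distrib_left)
        finally show ?thesis using \<alpha>(1) k by (simp add: field_simps)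
      qed
      then show ?case by blast
    qed
  qed measurable

  note decorrelate = asymptotically_invariant_decorrelates[OF t_meas t1 invariant]
  have "(\<lambda>n. \<integral>x. t n x * F x \<partial>M) \<longlonglongrightarrow> 0"
  proof -
    have eq: "(\<integral>x. t n x * F x \<partial>M) = ((\<integral>x. s n x \<partial>M) - (\<integral>x. r n x \<partial>M)) / 2" for n
    proof -
      have "(\<integral>x. t n x * F x \<partial>M) = (\<integral>x. (s n x - r n x) / 2 \<partial>M)"
      proof (rule integral_cong_AE)
        show "AE x in M. t n x * F x = (s n x - r n x) / 2"
          using AE_est by eventually_elim blast
      qed measurable
      then show ?thesis using si ri by simp
    qed
    have "(\<lambda>n. ((\<integral>x. s n x \<partial>M) - (\<integral>x. r n x \<partial>M)) / 2) \<longlonglongrightarrow> (1 - 1) / 2"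
      by (intro tendsto_intros s_lim r_lim) simp
    then show ?thesis unfolding eq by (simp only: diff_self div_0)
  qed
  from tendsto_diff[OF this decorrelate[OF Fi]]
  have mean: "(\<lambda>n. \<integral>x. t n x \<partial>M) \<longlonglongrightarrow> 0" by (simp add: F1)
  have weak: "(\<lambda>n. \<integral>x. t n x * g x \<partial>M) \<longlonglongrightarrow> 0" if g: "integrable M g" for g
    using tendsto_add[OF decorrelate[OF g] tendsto_mult_left_zero[OF mean, of "\<integral>x. g x \<partial>M"]] by simp
  show ?thesis
    by (intro exI[of _ t] conjI allI impI t_meas t1 close weak)
qed

text \<open>
  A functional that is bounded for the orbit norm is bounded for the \<open>L\<^sub>1\<close> norm. So it suffices to treat
  the multiples \<open>t n *\<^sub>R f\<close>, from which \<open>h n\<close> differs by a null sequence in \<open>L\<^sub>1\<close>. Since \<open>t n\<close> is real, the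
  components of the functional in a real basis of the scalar field can be treated one at a time,
  and the real and the complex case are the same.
\<close>

lemma wMLUR_orbit_norm:
  "wMLUR (L1 M :: ('w \<Rightarrow> 'k::{real_normed_field, euclidean_space}) set) (orbit_norm M T a)"
  unfolding wMLUR_def weakly_converges_def
proof (intro ballI allI impI)
  fix f :: "'w \<Rightarrow> 'k" and h :: "nat \<Rightarrow> 'w \<Rightarrow> 'k" and \<phi> :: "('w \<Rightarrow> 'k) \<Rightarrow> 'k"
  assume "f \<in> L1 M" "\<forall>n. h n \<in> L1 M" and norm1: "orbit_norm M T a f = 1"
    and lims: "(\<lambda>n. orbit_norm M T a (\<lambda>x. f x + h n x)) \<longlonglongrightarrow> 1"
      "(\<lambda>n. orbit_norm M T a (\<lambda>x. f x - h n x)) \<longlonglongrightarrow> 1"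
    and "\<phi> \<in> dual_space (L1 M) (orbit_norm M T a)"
  then have f: "integrable M f" and h: "\<And>n. integrable M (h n)"
    and add: "\<And>f g. integrable M f \<Longrightarrow> integrable M g \<Longrightarrow> \<phi> (\<lambda>x. f x + g x) = \<phi> f + \<phi> g"
    and scale: "\<And>c f. integrable M f \<Longrightarrow> \<phi> (\<lambda>x. c * f x) = c * \<phi> f"
    and "\<exists>C. \<forall>f. integrable M f \<longrightarrow> norm (\<phi> f) \<le> C * orbit_norm M T a f"
    by (auto simp: L1_def dual_space_def)
  then obtain C where C: "\<And>f. integrable M f \<Longrightarrow> norm (\<phi> f) \<le> C * orbit_norm M T a f" by blast
  define K where "K = \<bar>C\<bar> * (\<Sum>\<^sub>\<infinity>k. sqrt (a k))"
  have bound: "norm (\<phi> g) \<le> K * (\<integral>x. norm (g x) \<partial>M)" if g: "integrable M g" for g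
  proof -
    have "norm (\<phi> g) \<le> \<bar>C\<bar> * orbit_norm M T a g"
      using C[OF g] mult_right_mono[OF abs_ge_self[of C], of "orbit_norm M T a g"]
      by (simp add: orbit_norm_eq orbit_fun_nonneg)
    also have "\<dots> \<le> \<bar>C\<bar> * ((\<Sum>\<^sub>\<infinity>k. sqrt (a k)) * (\<integral>x. norm (g x) \<partial>M))"
      using orbit_fun_dominated(3)[OF g] by (intro mult_left_mono) (auto simp: orbit_norm_eq)
    finally show ?thesis by (simp add: K_def mult.assoc)
  qed
  obtain t :: "nat \<Rightarrow> 'w \<Rightarrow> real"
    where t: "\<And>n. t n \<in> borel_measurable M" "\<And>n x. \<bar>t n x\<bar> \<le> 1"
      and close: "(\<lambda>n. \<integral>x. norm (h n x - t n x *\<^sub>R f x) \<partial>M) \<longlonglongrightarrow> 0"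
      and weak: "\<And>g. integrable M g \<Longrightarrow> (\<lambda>n. \<integral>x. t n x * g x \<partial>M) \<longlonglongrightarrow> 0"
    using midpoint_perturbations_are_multiples[OF f h norm1 lims] by blast
  have tf: "integrable M (\<lambda>x. t n x *\<^sub>R f x)" for n
    by (rule bounded_measurable_integrable_scaleR[OF bounded_measurableI[OF t] f])
  have "(\<lambda>n. \<phi> (\<lambda>x. t n x *\<^sub>R f x) \<bullet> b) \<longlonglongrightarrow> 0" if b: "b \<in> Basis" for b
  proof (rule functional_tendsto_zero[where L="\<lambda>g. \<phi> g \<bullet> b", OF _ _ _ t weak f])
    show "\<phi> (\<lambda>x. c *\<^sub>R g x) \<bullet> b = c * (\<phi> g \<bullet> b)" if "integrable M g" for c g
      using scale[OF that, of "of_real c"] by (simp add: scaleR_conv_of_real[symmetric])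
    show "\<bar>\<phi> g \<bullet> b\<bar> \<le> K * (\<integral>x. norm (g x) \<partial>M)" if "integrable M g" for g
      using Basis_le_norm[OF b, of "\<phi> g"] bound[OF that] by linarith
  qed (auto simp: add inner_add_left)
  then have multiples: "(\<lambda>n. \<phi> (\<lambda>x. t n x *\<^sub>R f x)) \<longlonglongrightarrow> 0"
    by (intro tendsto_componentwise_iff[THEN iffD2]) simp
  have remainder: "(\<lambda>n. \<phi> (\<lambda>x. h n x - t n x *\<^sub>R f x)) \<longlonglongrightarrow> 0"
  proof (rule tendsto_norm_zero_cancel, rule tendsto_sandwich[OF _ _ tendsto_const])
    show "(\<lambda>n. K * (\<integral>x. norm (h n x - t n x *\<^sub>R f x) \<partial>M)) \<longlonglongrightarrow> 0"
      by (rule tendsto_mult_right_zero[OF close])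
  qed (auto intro!: always_eventually bound h tf)
  have "(\<lambda>n. \<phi> (\<lambda>x. t n x *\<^sub>R f x) + \<phi> (\<lambda>x. h n x - t n x *\<^sub>R f x)) \<longlonglongrightarrow> 0"
    using tendsto_add[OF multiples remainder] by simp
  moreover have "\<phi> (h n) = \<phi> (\<lambda>x. t n x *\<^sub>R f x) + \<phi> (\<lambda>x. h n x - t n x *\<^sub>R f x)" for n
    using add[OF tf[of n] Bochner_Integration.integrable_diff[OF h[of n] tf[of n]]] by simp
  moreover have "\<phi> (\<lambda>x. 0) = 0" using scale[OF f, of 0] by simp
  ultimately show "(\<lambda>n. \<phi> (h n)) \<longlonglongrightarrow> \<phi> (\<lambda>x. 0)" by simp
qed

end

theorem theorem3p5:
  fixes M :: "'w measure" and T :: "'w \<Rightarrow> 'w" and a :: "int \<Rightarrow> real"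
  assumes "prob_space M"
    and "invertible_mpt M T"
    and "ergodic M T"
    and "\<And>k. a k > 0"
    and "(a has_sum 1) UNIV"
    and "(\<lambda>k. sqrt (a k)) summable_on UNIV"
  shows "wMLUR (L1 M :: ('w \<Rightarrow> real) set) (orbit_norm M T a)
       \<and> wMLUR (L1 M :: ('w \<Rightarrow> complex) set) (orbit_norm M T a)"
proof -
  interpret prob_space M by fact
  interpret ergodic_orbit_weights M T a
    by unfold_locales (use assms in auto)
  show ?thesis by (intro conjI wMLUR_orbit_norm)
qed

end
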